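(* Let $\psi:\mathbb R\to\mathbb R$ be a non-decreasing function such that $-\log(1-x+x^2/2)\leq \psi(x)\leq \log(1+x+x^2/2)$ for all $x\in\mathbb R$. Let $Y_1,\ldots,Y_n\in \mathbb C^{d\times d}$ be independent self-adjoint random matrices with finite second moments of entries, let $\sigma_n^2=\| \sum_{j=1}^n\mathbb EY_j^2 \|$ and $\overline{\mathbb EY}:=\frac1n\sum_{j=1}^n\mathbb EY_j$, and let $\sigma_{\min},\sigma_{\max}$ be constants with $0<\sigma_{\min}\leq \sigma_n/\sqrt n \leq \sigma_{\max}$. Fix $t>0$. Let $\sigma_j = 2^j\sigma_{\min}$, $\mathcal J=\{ j\in \mathbb Z: \sigma_{\min} \leq \sigma_j < 2\sigma_{\max} \}$, and for $j\in\mathcal J$ let $\theta_j=\sqrt{\frac{2t}{n}}\frac{1}{\sigma_j}$ and $T_{n,j}=\frac{1}{n\theta_j}\sum_{i=1}^n \psi(\theta_j Y_i)$. Set \[ j_\ast:=\min\Big\{ j\in \mathcal J: \forall k\in\mathcal J \text{ with } k>j,\ \| T_{n,k} - T_{n,j} \|\leq 2 \sigma_{k} \sqrt{\tfrac{2t}{n}} \Big\} \] and $T_n^\ast:=T_{n,j_\ast}$. Then \[ \Pr\Big( \big\| T_n^\ast - \overline{\mathbb EY} \big\| \geq 6\frac{\sigma_n}{\sqrt{n}} \sqrt{\frac{2t}{n}} \Big)\leq 2d \log_2\Big(\frac{2\sigma_{\max}}{\sigma_{\min}}\Big) e^{-t}. \]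
   Context: $\|\cdot\|$ is the operator norm. For a real function $f$ and a self-adjoint matrix $A=U\,\mathrm{diag}(\lambda_i)\,U^\ast$, $f(A):=U\,\mathrm{diag}(f(\lambda_i))\,U^\ast$. Expectations are entrywise. *)

theory Defs
  imports "HOL-Probability.Probability"
begin

text \<open>Complex d x d matrices are modelled as complex^'d^'d (HOL-Analysis),
  acting on complex^'d with its Euclidean (L2) norm.\<close>

definition mat_adj :: "complex^'d^'d \<Rightarrow> complex^'d^'d" where
  "mat_adj A = (\<chi> i j. cnj (A $ j $ i))"

definition self_adjoint :: "complex^'d^'d \<Rightarrow> bool" where
  "self_adjoint A \<longleftrightarrow> mat_adj A = A"

definition unitary_mat :: "complex^'d^'d \<Rightarrow> bool" where
  "unitary_mat U \<longleftrightarrow> U ** mat_adj U = mat 1 \<and> mat_adj U ** U = mat 1"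

definition diag_mat :: "('d \<Rightarrow> real) \<Rightarrow> complex^'d^'d" where
  "diag_mat l = (\<chi> i j. if i = j then complex_of_real (l i) else 0)"

definition op_norm :: "complex^'d^'d \<Rightarrow> real" where
  "op_norm A = onorm (\<lambda>x::complex^'d. A *v x)"

definition mat_fun :: "(real \<Rightarrow> real) \<Rightarrow> complex^'d^'d \<Rightarrow> complex^'d^'d" where
  "mat_fun f A = (SOME B. \<exists>U l. unitary_mat U \<and> A = U ** diag_mat l ** mat_adj U
                        \<and> B = U ** diag_mat (\<lambda>i. f (l i)) ** mat_adj U)"

definition mat_expectation :: "'a measure \<Rightarrow> ('a \<Rightarrow> complex^'d^'d) \<Rightarrow> complex^'d^'d" where
  "mat_expectation M X = (\<chi> i j. integral\<^sup>L M (\<lambda>\<omega>. X \<omega> $ i $ j))"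

end

(*
  The Laplace transform of a sum of independent self-adjoint matrices is bounded by peeling off one
  summand at a time: if exp Z = 1 + Y + Y^2/2 and C = E Y + E Y^2 / 2, then Golden--Thompson gives
  E tr exp (S - C + Z) <= tr (exp (S - C) (1 + C)), and this is at most tr exp S because the convex
  function tr exp lies above its tangents. Hence E tr exp (sum (Z_i - C_i)) <= d, with the variance
  proxy norm (sum E Y_i^2), although Lieb's concavity theorem is not used. Since
  - g (- x) <= psi x <= g x for g x = ln (1 + x + x^2/2), only the continuous function g of Y_i has to
  be measurable.

  In Lepski's argument a plain union bound counts all indices j with sigma_j >= sigma_n / sqrt n,
  which is at most log2 (2 sigma_max / sigma_min) unless sigma_n / sqrt n = sigma_min. In that case
  j = 0 is treated with the wider threshold 2 sigma_0, which makes its failure probability negligible.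
*)
theory Submission
  imports Defs
begin

text \<open>Pulling out the operator norm of each factor after Golden--Thompson would leave the sum
  of the norms of the \<open>C i\<close>. Keeping \<open>C i\<close> in the exponent and undoing it
  by the tangent inequality preserves the matrix sum, so a norm is taken only once, at the end. The
  logarithm matters because \<open>exp\<close> of it is exactly a quadratic polynomial in the
  summand: its mean needs only second moments, and no remainder has to be estimated. Write
  \<open>v\<close> for the normalised standard deviation and \<open>s = sqrt (2 * t / n)\<close>.
  With \<open>\<theta> k = s / \<sigma> k\<close> and threshold \<open>c * \<sigma> k * s\<close>,
  the tail exponent is \<open>t * (v / \<sigma> k)^2 - 2 * t * c\<close>; for \<open>c = 1\<close>
  it is at most \<open>- t\<close> as soon as \<open>v \<le> \<sigma> k\<close>. The selection rule
  turns accuracy \<open>c * \<sigma> j * s\<close> into \<open>(2 + c) * \<sigma> j * s\<close>. The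
  smallest scale above \<open>v\<close> satisfies \<open>\<sigma> j \<le> 2 * v\<close>, which gives
  the constant 3 * 2 = 6.\<close>

section \<open>The operator norm of complex matrices\<close>

lemma bounded_linear_mat_mult_vec:
  "bounded_linear (\<lambda>x. A *v x)" for A :: "complex^'d^'d"
  by (rule matrix_vector_mul_bounded_linear)

lemma norm_mat_mult_vec_le: "norm (A *v x) \<le> op_norm A * norm x" for A :: "complex^'d^'d"
  unfolding op_norm_def by (rule onorm[OF bounded_linear_mat_mult_vec])

lemma op_norm_le: "(\<And>x. norm (A *v x) \<le> b * norm x) \<Longrightarrow> op_norm A \<le> b"
  for A :: "complex^'d^'d"
  unfolding op_norm_def by (rule onorm_le)

lemma op_norm_nonneg: "0 \<le> op_norm A" for A :: "complex^'d^'d"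
  unfolding op_norm_def by (rule onorm_pos_le[OF bounded_linear_mat_mult_vec])

lemma norm_entry_le_op_norm: "norm (A $ i $ j) \<le> op_norm A" for A :: "complex^'d^'d"
proof -
  have "A $ i $ j = (A *v axis j 1) $ i"
    by (simp add: matrix_vector_mult_def axis_def if_distrib [where f="\<lambda>x. _ * x"] cong: if_cong)
  then have "norm (A $ i $ j) \<le> norm (A *v axis j 1)"
    by (simp add: Finite_Cartesian_Product.norm_nth_le)
  also have "\<dots> \<le> op_norm A * norm (axis j 1 :: complex^'d)"
    by (rule norm_mat_mult_vec_le)
  finally show ?thesis by simp
qed

lemma op_norm_le_sum_entries: "op_norm A \<le> (\<Sum>i\<in>UNIV. \<Sum>j\<in>UNIV. norm (A $ i $ j))"
  for A :: "complex^'d^'d"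
proof (rule op_norm_le)
  fix x :: "complex^'d"
  have "norm (A *v x) \<le> (\<Sum>i\<in>UNIV. norm ((A *v x) $ i))"
    by (simp add: norm_vec_def L2_set_le_sum)
  also have "\<dots> \<le> (\<Sum>i\<in>UNIV. (\<Sum>j\<in>UNIV. norm (A $ i $ j)) * norm x)"
  proof (rule sum_mono)
    fix i
    have "norm ((A *v x) $ i) \<le> (\<Sum>j\<in>UNIV. norm (A $ i $ j * x $ j))"
      by (simp add: matrix_vector_mult_def norm_sum)
    also have "\<dots> \<le> (\<Sum>j\<in>UNIV. norm (A $ i $ j) * norm x)"
      by (intro sum_mono) (simp add: norm_mult mult_left_mono Finite_Cartesian_Product.norm_nth_le)
    finally show "norm ((A *v x) $ i) \<le> (\<Sum>j\<in>UNIV. norm (A $ i $ j)) * norm x"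
      by (simp add: sum_distrib_right)
  qed
  finally show "norm (A *v x) \<le> (\<Sum>i\<in>UNIV. \<Sum>j\<in>UNIV. norm (A $ i $ j)) * norm x"
    by (simp add: sum_distrib_right)
qed

lemma op_norm_triangle: "op_norm (A + B) \<le> op_norm A + op_norm B" for A B :: "complex^'d^'d"
  unfolding op_norm_def matrix_vector_mult_add_rdistrib
  by (rule onorm_triangle; rule bounded_linear_mat_mult_vec)

lemma scaleR_mat_mult_vec: "(c *\<^sub>R A) *v x = c *\<^sub>R (A *v x)" for A :: "complex^'d^'d"
  by (simp add: vec_eq_iff matrix_vector_mult_def scaleR_sum_right)

lemma op_norm_scaleR: "op_norm (c *\<^sub>R A) = \<bar>c\<bar> * op_norm A" for A :: "complex^'d^'d"
  unfolding op_norm_def scaleR_mat_mult_vec by (rule onorm_scaleR[OF bounded_linear_mat_mult_vec])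

lemma op_norm_mult: "op_norm (A ** B) \<le> op_norm A * op_norm B" for A B :: "complex^'d^'d"
proof (rule op_norm_le)
  fix x
  have "norm ((A ** B) *v x) \<le> op_norm A * norm (B *v x)"
    by (metis matrix_vector_mul_assoc norm_mat_mult_vec_le)
  also have "\<dots> \<le> op_norm A * (op_norm B * norm x)"
    by (intro mult_left_mono norm_mat_mult_vec_le op_norm_nonneg)
  finally show "norm ((A ** B) *v x) \<le> op_norm A * op_norm B * norm x" by simp
qed

lemma op_norm_mat1: "op_norm (mat 1 :: complex^'d^'d) = 1"
  unfolding op_norm_def matrix_vector_mul_lid by (rule onorm_id)

lemma op_norm_eq_0: "op_norm A = 0 \<longleftrightarrow> A = 0" for A :: "complex^'d^'d"
proof
  assume "op_norm A = 0"
  then have "norm (A $ i $ j) \<le> 0" for i j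
    using norm_entry_le_op_norm[of A i j] by simp
  then show "A = 0" by (simp add: vec_eq_iff)
qed (simp add: op_norm_def onorm_zero)

section \<open>Complex square matrices as a Banach algebra\<close>

text \<open>The product and norm that \<open>complex^'d^'d\<close> carries as a vector type are
  componentwise and Euclidean. On a copy of the type, \<open>*\<close>, powers and
  \<open>norm\<close> can mean matrix product and operator norm, so that the generic
  \<open>exp\<close> on Banach algebras is the matrix exponential.\<close>

typedef 'd cmat = "UNIV :: (complex^'d^'d) set"
  morphisms mat_of Cmat ..

setup_lifting type_definition_cmat

instantiation cmat :: (finite) real_normed_algebra_1
begin

lift_definition zero_cmat :: "'a cmat" is 0 .
lift_definition one_cmat :: "'a cmat" is "mat 1" .
lift_definition plus_cmat :: "'a cmat \<Rightarrow> 'a cmat \<Rightarrow> 'a cmat" is "(+)" .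
lift_definition minus_cmat :: "'a cmat \<Rightarrow> 'a cmat \<Rightarrow> 'a cmat" is "(-)" .
lift_definition uminus_cmat :: "'a cmat \<Rightarrow> 'a cmat" is uminus .
lift_definition times_cmat :: "'a cmat \<Rightarrow> 'a cmat \<Rightarrow> 'a cmat" is "(**)" .
lift_definition scaleR_cmat :: "real \<Rightarrow> 'a cmat \<Rightarrow> 'a cmat" is "(*\<^sub>R)" .
lift_definition norm_cmat :: "'a cmat \<Rightarrow> real" is op_norm .
definition dist_cmat :: "'a cmat \<Rightarrow> 'a cmat \<Rightarrow> real" where "dist_cmat a b = norm (a - b)"
definition sgn_cmat :: "'a cmat \<Rightarrow> 'a cmat" where "sgn_cmat a = inverse (norm a) *\<^sub>R a"
definition uniformity_cmat :: "('a cmat \<times> 'a cmat) filter"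
  where "uniformity_cmat = (INF e\<in>{0 <..}. principal {(x, y). dist x y < e})"
definition open_cmat :: "'a cmat set \<Rightarrow> bool"
  where "open_cmat S = (\<forall>x\<in>S. \<forall>\<^sub>F (x', y) in uniformity. x' = x \<longrightarrow> y \<in> S)"

instance
proof
  fix a b c :: "'a cmat" and r s :: real
  show "dist a b = norm (a - b)" by (rule dist_cmat_def)
  show "sgn a = inverse (norm a) *\<^sub>R a" by (rule sgn_cmat_def)
  show "(uniformity :: ('a cmat \<times> 'a cmat) filter)
      = (INF e\<in>{0 <..}. principal {(x, y). dist x y < e})"
    by (rule uniformity_cmat_def)
  show "open U = (\<forall>x\<in>U. \<forall>\<^sub>F (x', y) in uniformity. x' = x \<longrightarrow> y \<in> U)" for U :: "'a cmat set"
    by (rule open_cmat_def)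
  show "a + b + c = a + (b + c)" by transfer simp
  show "a + b = b + a" by transfer simp
  show "0 + a = a" by transfer simp
  show "- a + a = 0" by transfer simp
  show "a - b = a + - b" by transfer simp
  show "r *\<^sub>R (a + b) = r *\<^sub>R a + r *\<^sub>R b" by transfer (simp add: scaleR_add_right)
  show "(r + s) *\<^sub>R a = r *\<^sub>R a + s *\<^sub>R a" by transfer (simp add: scaleR_add_left)
  show "r *\<^sub>R s *\<^sub>R a = (r * s) *\<^sub>R a" by transfer simp
  show "1 *\<^sub>R a = a" by transfer simp
  show "a * b * c = a * (b * c)" by transfer (simp add: matrix_mul_assoc)
  show "(a + b) * c = a * c + b * c" by transfer (simp add: vec_eq_iff matrix_matrix_mult_def distrib_right sum.distrib)
  show "a * (b + c) = a * b + a * c" by transfer (simp add: matrix_add_ldistrib)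
  show "r *\<^sub>R a * b = r *\<^sub>R (a * b)"
    by transfer (simp add: vec_eq_iff matrix_matrix_mult_def scaleR_sum_right)
  show "a * r *\<^sub>R b = r *\<^sub>R (a * b)"
    by transfer (simp add: vec_eq_iff matrix_matrix_mult_def scaleR_sum_right)
  show "1 * a = a" by transfer simp
  show "a * 1 = a" by transfer simp
  show "(0 :: 'a cmat) \<noteq> 1" by transfer (metis op_norm_mat1 op_norm_eq_0 zero_neq_one)
  show "norm a = 0 \<longleftrightarrow> a = 0" by transfer (rule op_norm_eq_0)
  show "norm (a + b) \<le> norm a + norm b" by transfer (rule op_norm_triangle)
  show "norm (r *\<^sub>R a) = \<bar>r\<bar> * norm a" by transfer (rule op_norm_scaleR)
  show "norm (a * b) \<le> norm a * norm b" by transfer (rule op_norm_mult)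
  show "norm (1 :: 'a cmat) = 1" by transfer (rule op_norm_mat1)
qed

end

lift_definition entry :: "'d::finite cmat \<Rightarrow> 'd \<Rightarrow> 'd \<Rightarrow> complex" is "\<lambda>A i j. A $ i $ j" .

lemma cmat_eqI: "(\<And>i j. entry A i j = entry B i j) \<Longrightarrow> A = B"
  by transfer (simp add: vec_eq_iff)

lemma entry_zero [simp]: "entry 0 i j = 0"
  and entry_one: "entry 1 i j = (if i = j then 1 else 0)"
  and entry_add [simp]: "entry (A + B) i j = entry A i j + entry B i j"
  and entry_diff [simp]: "entry (A - B) i j = entry A i j - entry B i j"
  and entry_scaleR [simp]: "entry (c *\<^sub>R A) i j = c *\<^sub>R entry A i j"
  and entry_mult: "entry (A * B) i j = (\<Sum>k\<in>UNIV. entry A i k * entry B k j)"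
  by (transfer, simp add: mat_def matrix_matrix_mult_def)+

lemma norm_entry_le: "norm (entry A i j) \<le> norm A"
  by transfer (rule norm_entry_le_op_norm)

lemma norm_cmat_le: "norm A \<le> (\<Sum>i\<in>UNIV. \<Sum>j\<in>UNIV. norm (entry A i j))"
  by transfer (rule op_norm_le_sum_entries)

lemma bounded_linear_entry: "bounded_linear (\<lambda>A. entry A i j)"
  by (rule bounded_linear_intro[where K=1]) (auto simp: norm_entry_le)

text \<open>Norm and entries control each other: every entry is at most the norm, and the norm is at
  most the sum of the moduli of all entries. Completeness and limits of diagonal matrices thereby
  reduce to scalar sequences.\<close>

lemma tendsto_cmat_iff:
  "(f \<longlongrightarrow> A) F \<longleftrightarrow> (\<forall>i j. ((\<lambda>x. entry (f x) i j) \<longlongrightarrow> entry A i j) F)"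
proof
  show "(f \<longlongrightarrow> A) F \<Longrightarrow> \<forall>i j. ((\<lambda>x. entry (f x) i j) \<longlongrightarrow> entry A i j) F"
    by (intro allI bounded_linear.tendsto[OF bounded_linear_entry])
next
  assume *: "\<forall>i j. ((\<lambda>x. entry (f x) i j) \<longlongrightarrow> entry A i j) F"
  have "((\<lambda>x. \<Sum>i\<in>UNIV. \<Sum>j\<in>UNIV. norm (entry (f x - A) i j))
      \<longlongrightarrow> (\<Sum>i\<in>UNIV. \<Sum>j\<in>UNIV. norm (entry A i j - entry A i j))) F"
    unfolding entry_diff using * by (intro tendsto_intros) auto
  then have "((\<lambda>x. \<Sum>i\<in>UNIV. \<Sum>j\<in>UNIV. norm (entry (f x - A) i j)) \<longlongrightarrow> 0) F"
    by simp
  then have "((\<lambda>x. f x - A) \<longlongrightarrow> 0) F"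
    by (rule Lim_null_comparison[rotated]) (intro always_eventually allI norm_cmat_le)
  then show "(f \<longlongrightarrow> A) F" by (rule LIM_zero_cancel)
qed

instance cmat :: (finite) banach
proof
  fix X :: "nat \<Rightarrow> 'a cmat"
  assume "Cauchy X"
  then have "convergent (\<lambda>n. entry (X n) i j)" for i j
    by (simp add: bounded_linear.Cauchy[OF bounded_linear_entry] Cauchy_convergent)
  then obtain L where L: "(\<lambda>n. entry (X n) i j) \<longlonglongrightarrow> L i j" for i j
    unfolding convergent_def by metis
  have "X \<longlonglongrightarrow> Cmat (\<chi> i j. L i j)"
    unfolding tendsto_cmat_iff using L by (simp add: entry.abs_eq)
  then show "convergent X" unfolding convergent_def by blast
qed

section \<open>Adjoint and trace\<close>

lift_definition adj :: "'d::finite cmat \<Rightarrow> 'd cmat" is mat_adj .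

definition tr :: "'d::finite cmat \<Rightarrow> complex" where
  "tr A = (\<Sum>i\<in>UNIV. entry A i i)"

lemma entry_adj [simp]: "entry (adj A) i j = cnj (entry A j i)"
  by transfer (simp add: mat_adj_def)

lemma adj_adj [simp]: "adj (adj A) = A"
  and adj_zero [simp]: "adj 0 = 0"
  and adj_one [simp]: "adj 1 = 1"
  and adj_add [simp]: "adj (A + B) = adj A + adj B"
  and adj_diff [simp]: "adj (A - B) = adj A - adj B"
  and adj_scaleR [simp]: "adj (c *\<^sub>R A) = c *\<^sub>R adj A"
  and adj_mult [simp]: "adj (A * B) = adj B * adj A"
  by (rule cmat_eqI, simp add: entry_one entry_mult mult.commute)+

lemma adj_sum [simp]: "adj (sum f I) = (\<Sum>i\<in>I. adj (f i))"
  by (induction I rule: infinite_finite_induct) auto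

lemma adj_power [simp]: "adj (A ^ n) = adj A ^ n"
  by (induction n) (auto simp: power_commutes)

lemma bounded_linear_adj: "bounded_linear (adj :: 'd::finite cmat \<Rightarrow> 'd cmat)"
proof (rule bounded_linear_intro)
  fix A :: "'d cmat"
  have "norm (adj A) \<le> (\<Sum>i\<in>UNIV. \<Sum>j\<in>UNIV. norm (entry (adj A) i j))"
    by (rule norm_cmat_le)
  also have "\<dots> \<le> (\<Sum>(i::'d)\<in>UNIV. \<Sum>(j::'d)\<in>UNIV. norm A)"
    by (intro sum_mono) (simp add: norm_entry_le)
  finally show "norm (adj A) \<le> norm A * (real CARD('d) * real CARD('d))"
    by (simp add: mult_ac)
qed auto

lemma adj_exp [simp]: "adj (exp A) = exp (adj A)"
  unfolding exp_def
  by (subst bounded_linear.suminf[OF bounded_linear_adj summable_exp_generic]) simp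

lemma tr_one: "tr (1 :: 'd::finite cmat) = of_nat CARD('d)"
  and tr_add: "tr (A + B) = tr A + tr B"
  by (simp_all add: tr_def entry_one sum.distrib)

lemma tr_mult_commute: "tr (A * B) = tr (B * A)"
  unfolding tr_def entry_mult by (subst sum.swap) (simp add: mult.commute)

lemma bounded_linear_tr: "bounded_linear tr"
  unfolding tr_def [abs_def] by (intro bounded_linear_sum bounded_linear_entry)

text \<open>This is the squared Hilbert--Schmidt norm; in particular such a trace is real and
  nonnegative.\<close>

lemma tr_mult_adj: "tr (A * adj A) = of_real (\<Sum>i\<in>UNIV. \<Sum>j\<in>UNIV. (norm (entry A i j))\<^sup>2)"
  by (simp only: tr_def entry_mult entry_adj of_real_sum complex_norm_square)

text \<open>The Hilbert--Schmidt inner product of \<open>B\<close> and \<open>adj A\<close>, with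
  matrices read as vectors indexed by pairs.\<close>

lemma tr_Cauchy_Schwarz:
  "(norm (tr (A * B)))\<^sup>2 \<le> Re (tr (A * adj A)) * Re (tr (adj B * B))"
proof -
  have A: "Re (tr (A * adj A)) = (\<Sum>p\<in>UNIV. (norm (entry A (fst p) (snd p)))\<^sup>2)"
    by (simp add: tr_mult_adj sum.cartesian_product flip: UNIV_Times_UNIV) (simp add: case_prod_unfold)
  have "tr (adj B * B) = tr (adj B * adj (adj B))" by simp
  also have "Re \<dots> = (\<Sum>i\<in>UNIV. \<Sum>j\<in>UNIV. (norm (entry B j i))\<^sup>2)"
    by (subst tr_mult_adj) simp
  finally have B: "Re (tr (adj B * B)) = (\<Sum>p\<in>UNIV. (norm (entry B (snd p) (fst p)))\<^sup>2)"
    by (simp add: sum.cartesian_product flip: UNIV_Times_UNIV) (simp add: case_prod_unfold)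
  have "tr (A * B) = (\<Sum>p\<in>UNIV. entry A (fst p) (snd p) * entry B (snd p) (fst p))"
    by (simp add: tr_def entry_mult sum.cartesian_product flip: UNIV_Times_UNIV) (simp add: case_prod_unfold)
  then have "norm (tr (A * B)) \<le> (\<Sum>p\<in>UNIV. norm (entry A (fst p) (snd p)) * norm (entry B (snd p) (fst p)))"
    by (simp add: norm_sum flip: norm_mult)
  then have "(norm (tr (A * B)))\<^sup>2
      \<le> (\<Sum>p\<in>UNIV. norm (entry A (fst p) (snd p)) * norm (entry B (snd p) (fst p)))\<^sup>2"
    by (intro power_mono) auto
  also have "\<dots> \<le> (\<Sum>p\<in>UNIV. (norm (entry A (fst p) (snd p)))\<^sup>2) * (\<Sum>p\<in>UNIV. (norm (entry B (snd p) (fst p)))\<^sup>2)"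
    by (rule Cauchy_Schwarz_ineq_sum)
  finally show ?thesis by (simp add: A B)
qed

lemma power_mult_rotate: "(x * y) ^ n * x = x * (y * x) ^ n" for x y :: "'a::monoid_mult"
  by (induction n) (simp_all add: mult.assoc)

lemma tr_power_mult_commute: "tr ((A * B) ^ n) = tr ((B * A) ^ n)"
proof (cases n)
  case (Suc m)
  have "tr ((A * B) ^ n) = tr (((A * B) ^ m * A) * B)"
    by (simp add: Suc power_commutes mult.assoc flip: power_Suc2)
  also have "\<dots> = tr (B * (A * (B * A) ^ m))"
    by (simp only: power_mult_rotate tr_mult_commute)
  finally show ?thesis by (simp add: Suc mult.assoc)
qed simp

section \<open>The Golden--Thompson inequality\<close>

text \<open>Two trace inequalities proved together because each step of one uses the other. The
  first, for \<open>P * Q\<close>, followed by cyclic rotation, reduces the second to the squares of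
  \<open>P\<close> and \<open>Q\<close>; the second, for \<open>adj A * A\<close> and
  \<open>A * adj A\<close>, closes the step of the first. Squaring is the only operation, hence
  exponents that are powers of two.\<close>

lemma tr_power2_bounds:
  fixes k :: nat
  shows "(\<forall>A :: 'd::finite cmat. norm (tr (A ^ 2 ^ Suc k)) \<le> Re (tr ((A * adj A) ^ 2 ^ k)))
    \<and> (\<forall>P Q :: 'd cmat. adj P = P \<longrightarrow> adj Q = Q \<longrightarrow>
        Re (tr ((P * Q) ^ 2 ^ k)) \<le> Re (tr (P ^ 2 ^ k * Q ^ 2 ^ k)))"
proof (induction k)
  case 0
  have "norm (tr (A * A)) \<le> Re (tr (A * adj A))" for A :: "'d cmat"
  proof (rule power2_le_imp_le)
    show "(norm (tr (A * A)))\<^sup>2 \<le> (Re (tr (A * adj A)))\<^sup>2"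
      using tr_Cauchy_Schwarz[of A A] by (simp add: tr_mult_commute[of "adj A"] power2_eq_square)
    show "0 \<le> Re (tr (A * adj A))" by (simp add: tr_mult_adj sum_nonneg)
  qed
  then show ?case by (simp add: power2_eq_square)
next
  case (Suc k)
  have IH1: "norm (tr (A ^ 2 ^ Suc k)) \<le> Re (tr ((A * adj A) ^ 2 ^ k))" for A :: "'d cmat"
    using Suc by blast
  have IH2: "Re (tr ((P * Q) ^ 2 ^ k)) \<le> Re (tr (P ^ 2 ^ k * Q ^ 2 ^ k))"
    if "adj P = P" "adj Q = Q" for P Q :: "'d cmat"
    using Suc that by blast
  have pow: "(x ^ 2) ^ m = x ^ (2 * m)" for x :: "'d cmat" and m
    by (simp add: power_mult)
  show ?case
  proof (intro conjI allI impI)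
    fix P Q :: "'d cmat"
    assume PQ: "adj P = P" "adj Q = Q"
    have "Re (tr ((P * Q) ^ 2 ^ Suc k)) \<le> norm (tr ((P * Q) ^ 2 ^ Suc k))"
      by (rule complex_Re_le_cmod)
    also have "\<dots> \<le> Re (tr ((P * Q * adj (P * Q)) ^ 2 ^ k))" by (rule IH1)
    \<comment> \<open>Bracketed so that cyclicity moves the leading \<open>P\<close> to the end,
      leaving only squares.\<close>
    also have "P * Q * adj (P * Q) = P * (Q\<^sup>2 * P)"
      using PQ by (simp add: power2_eq_square mult.assoc)
    also have "tr (\<dots> ^ 2 ^ k) = tr ((Q\<^sup>2 * P\<^sup>2) ^ 2 ^ k)"
      by (subst tr_power_mult_commute) (simp add: power2_eq_square mult.assoc)
    also have "\<dots> = tr ((P\<^sup>2 * Q\<^sup>2) ^ 2 ^ k)" by (rule tr_power_mult_commute)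
    also have "Re \<dots> \<le> Re (tr ((P\<^sup>2) ^ 2 ^ k * (Q\<^sup>2) ^ 2 ^ k))"
      using PQ by (intro IH2) simp_all
    finally show "Re (tr ((P * Q) ^ 2 ^ Suc k)) \<le> Re (tr (P ^ 2 ^ Suc k * Q ^ 2 ^ Suc k))"
      by (simp add: pow)
  next
    fix A :: "'d cmat"
    let ?P = "adj A * A" and ?Q = "A * adj A" and ?m = "2 ^ k :: nat"
    have "norm (tr (A ^ 2 ^ Suc (Suc k))) = norm (tr ((A\<^sup>2) ^ 2 ^ Suc k))"
      by (simp add: pow)
    also have "\<dots> \<le> Re (tr ((A\<^sup>2 * adj (A\<^sup>2)) ^ ?m))" by (rule IH1)
    also have "A\<^sup>2 * adj (A\<^sup>2) = A * (?Q * adj A)"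
      by (simp add: power2_eq_square mult.assoc)
    also have "tr (\<dots> ^ ?m) = tr ((?Q * ?P) ^ ?m)"
      by (subst tr_power_mult_commute) (simp add: mult.assoc)
    also have "\<dots> = tr ((?P * ?Q) ^ ?m)" by (rule tr_power_mult_commute)
    also have "Re \<dots> \<le> Re (tr (?P ^ ?m * ?Q ^ ?m))"
      by (intro IH2) simp_all
    also have "\<dots> \<le> norm (tr (?P ^ ?m * ?Q ^ ?m))" by (rule complex_Re_le_cmod)
    \<comment> \<open>Cauchy--Schwarz bounds the square by the traces of
      \<open>?P ^ (2 * ?m)\<close> and \<open>?Q ^ (2 * ?m)\<close>, which coincide by
      cyclicity.\<close>
    also have "\<dots> \<le> Re (tr (?Q ^ (2 * ?m)))"
    proof (rule power2_le_imp_le)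
      have "tr (?P ^ (2 * ?m)) = tr (?Q ^ (2 * ?m))" by (rule tr_power_mult_commute)
      then show "(norm (tr (?P ^ ?m * ?Q ^ ?m)))\<^sup>2 \<le> (Re (tr (?Q ^ (2 * ?m))))\<^sup>2"
        using tr_Cauchy_Schwarz[of "?P ^ ?m" "?Q ^ ?m"]
        by (simp add: power2_eq_square mult_2 power_add)
      have "?Q ^ (2 * ?m) = ?Q ^ ?m * adj (?Q ^ ?m)" by (simp add: mult_2 power_add)
      then show "0 \<le> Re (tr (?Q ^ (2 * ?m)))" by (simp only: tr_mult_adj) (simp add: sum_nonneg)
    qed
    finally show "norm (tr (A ^ 2 ^ Suc (Suc k))) \<le> Re (tr (?Q ^ 2 ^ Suc k))" by simp
  qed
qed

text \<open>Telescoping: replace the factors \<open>x\<close> by \<open>y\<close> one at a time.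
  Stated for \<open>Suc n\<close> to keep the exponent \<open>n\<close> on the right free of
  subtraction.\<close>

lemma norm_power_diff_le:
  fixes x y :: "'a::real_normed_algebra_1"
  assumes "norm x \<le> m" "norm y \<le> m"
  shows "norm (x ^ Suc n - y ^ Suc n) \<le> real (Suc n) * m ^ n * norm (x - y)"
proof (induction n)
  case (Suc n)
  have m: "0 \<le> m" using assms(1) norm_ge_zero by (rule order_trans[rotated])
  have "x ^ Suc (Suc n) - y ^ Suc (Suc n) = x * (x ^ Suc n - y ^ Suc n) + (x - y) * y ^ Suc n"
    by (simp add: algebra_simps)
  also have "norm \<dots> \<le> norm x * norm (x ^ Suc n - y ^ Suc n) + norm (x - y) * norm (y ^ Suc n)"
    by (intro order_trans[OF norm_triangle_ineq] add_mono norm_mult_ineq)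
  also have "\<dots> \<le> m * (real (Suc n) * m ^ n * norm (x - y)) + norm (x - y) * m ^ Suc n"
    using assms m Suc
    by (intro add_mono mult_mono order_trans[OF norm_power_ineq] power_mono mult_nonneg_nonneg) auto
  finally show ?case by (simp add: algebra_simps)
qed simp

lemma exp_scaleR_inverse_power2:
  fixes A :: "'a::{real_normed_algebra_1,banach}"
  shows "exp (inverse (2 ^ k) *\<^sub>R A) ^ 2 ^ k = exp A"
proof (induction k arbitrary: A)
  case (Suc k)
  have "exp (inverse (2 ^ Suc k) *\<^sub>R A) ^ 2 ^ Suc k = (exp (inverse (2 ^ k) *\<^sub>R ((1/2) *\<^sub>R A)) ^ 2 ^ k)\<^sup>2"
    by (simp add: power_mult mult.commute[of 2])
  also have "\<dots> = exp A"
    unfolding Suc power2_eq_square by (subst exp_add_commuting[symmetric]) (simp_all flip: scaleR_add_left)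
  finally show ?case .
qed simp

text \<open>At step size \<open>h = 1 / 2 ^ k\<close> the error \<open>f h\<close> of a single step
  is o(h), since \<open>f\<close> and its derivative vanish at 0. Telescoping over
  \<open>2 ^ k = 1 / h\<close> steps multiplies it by at most \<open>K / h\<close>. Dyadic steps
  suffice, as the trace inequality is available for dyadic powers.\<close>

lemma Lie_Trotter:
  fixes A B :: "'a::{real_normed_algebra_1,banach}"
  shows "(\<lambda>k. (exp (inverse (2 ^ k) *\<^sub>R A) * exp (inverse (2 ^ k) *\<^sub>R B)) ^ 2 ^ k) \<longlonglongrightarrow> exp (A + B)"
proof -
  define h :: "nat \<Rightarrow> real" where "h k = inverse (2 ^ k)" for k
  define f where "f t = exp (t *\<^sub>R A) * exp (t *\<^sub>R B) - exp (t *\<^sub>R (A + B))" for t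
  define K where "K = exp (norm A + norm B)"
  have h0: "0 < h k" "h k * 2 ^ k = 1" for k by (auto simp: h_def)
  have "(f has_vector_derivative (exp (0 *\<^sub>R A) * (B * exp (0 *\<^sub>R B)) + A * exp (0 *\<^sub>R A) * exp (0 *\<^sub>R B)
      - (A + B) * exp (0 *\<^sub>R (A + B)))) (at 0)"
    unfolding f_def
    by (intro has_vector_derivative_diff has_vector_derivative_mult exp_scaleR_has_vector_derivative_left)
  then have "(f has_vector_derivative 0) (at 0)" by simp
  then have "((\<lambda>t. norm (f t) / norm t) \<longlongrightarrow> 0) (at 0)"
    by (simp add: has_vector_derivative_def has_derivative_at f_def)
  moreover have "filterlim h (at 0) sequentially"
  proof -
    have "h \<longlonglongrightarrow> 0" unfolding h_def by (rule LIMSEQ_inverse_realpow_zero) simp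
    then show ?thesis using h0(1) by (auto simp: filterlim_at less_imp_neq[symmetric])
  qed
  ultimately have "(\<lambda>k. norm (f (h k)) / norm (h k)) \<longlonglongrightarrow> 0"
    by (rule filterlim_compose)
  then have lim: "(\<lambda>k. K * (norm (f (h k)) / norm (h k))) \<longlonglongrightarrow> 0"
    by (rule tendsto_mult_right_zero)
  have bound: "norm ((exp (h k *\<^sub>R A) * exp (h k *\<^sub>R B)) ^ 2 ^ k - exp (A + B)) \<le> K * (norm (f (h k)) / norm (h k))"
    for k
  proof -
    define m where "m = exp (h k * (norm A + norm B))"
    define N where "N = (2::nat) ^ k - 1"
    have N: "2 ^ k = Suc N" by (simp add: N_def)
    have x: "norm (exp (h k *\<^sub>R A) * exp (h k *\<^sub>R B)) \<le> m"
    proof -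
      have "norm (exp (h k *\<^sub>R A) * exp (h k *\<^sub>R B)) \<le> exp (norm (h k *\<^sub>R A)) * exp (norm (h k *\<^sub>R B))"
        by (intro order_trans[OF norm_mult_ineq] mult_mono norm_exp) auto
      also have "\<dots> = m" using h0(1)[of k] by (simp add: m_def exp_add distrib_left)
      finally show ?thesis .
    qed
    have y: "norm (exp (h k *\<^sub>R (A + B))) \<le> m"
    proof -
      have "norm (exp (h k *\<^sub>R (A + B))) \<le> exp (norm (h k *\<^sub>R (A + B)))" by (rule norm_exp)
      also have "\<dots> \<le> m"
        using h0(1)[of k] norm_triangle_ineq[of A B] by (simp add: m_def)
      finally show ?thesis .
    qed
    \<comment> \<open>Here \<open>m\<close> is at least 1, and \<open>h k * 2 ^ k = 1\<close> makes
      the larger power independent of \<open>k\<close>.\<close>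
    have "m ^ N \<le> m ^ 2 ^ k"
      by (rule power_increasing) (use h0(1)[of k] in \<open>auto simp: N m_def\<close>)
    also have "\<dots> = K"
      using h0(2)[of k] by (simp add: m_def K_def mult_ac flip: exp_of_nat_mult)
    finally have mK: "m ^ N \<le> K" .
    have "norm ((exp (h k *\<^sub>R A) * exp (h k *\<^sub>R B)) ^ Suc N - exp (h k *\<^sub>R (A + B)) ^ Suc N)
        \<le> real (Suc N) * m ^ N * norm (f (h k))"
      unfolding f_def by (rule norm_power_diff_le[OF x y])
    also have "\<dots> \<le> real (Suc N) * K * norm (f (h k))"
      using mK by (intro mult_right_mono mult_left_mono) auto
    also have "real (Suc N) = 1 / norm (h k)"
      unfolding N[symmetric] using h0[of k] by (simp add: field_simps)
    finally show ?thesis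
      unfolding N[symmetric] by (simp add: h_def exp_scaleR_inverse_power2 mult_ac)
  qed
  have "(\<lambda>k. (exp (h k *\<^sub>R A) * exp (h k *\<^sub>R B)) ^ 2 ^ k - exp (A + B)) \<longlonglongrightarrow> 0"
    by (rule Lim_null_comparison[OF _ lim]) (intro always_eventually allI bound)
  then show ?thesis unfolding h_def by (rule LIM_zero_cancel)
qed

text \<open>For the factors \<open>exp (A / 2 ^ k)\<close> and \<open>exp (B / 2 ^ k)\<close> the
  right-hand side of the dyadic trace inequality does not depend on \<open>k\<close>, while the
  left-hand side converges by the product formula.\<close>

theorem Golden_Thompson:
  assumes "adj A = A" "adj B = B"
  shows "Re (tr (exp (A + B))) \<le> Re (tr (exp A * exp B))"
proof (rule LIMSEQ_le_const2)
  show "(\<lambda>k. Re (tr ((exp (inverse (2 ^ k) *\<^sub>R A) * exp (inverse (2 ^ k) *\<^sub>R B)) ^ 2 ^ k)))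
      \<longlonglongrightarrow> Re (tr (exp (A + B)))"
    by (intro tendsto_Re bounded_linear.tendsto[OF bounded_linear_tr] Lie_Trotter)
  have "Re (tr ((exp (inverse (2 ^ k) *\<^sub>R A) * exp (inverse (2 ^ k) *\<^sub>R B)) ^ 2 ^ k))
      \<le> Re (tr (exp (inverse (2 ^ k) *\<^sub>R A) ^ 2 ^ k * exp (inverse (2 ^ k) *\<^sub>R B) ^ 2 ^ k))" for k
    by (rule tr_power2_bounds[THEN conjunct2, rule_format]) (simp_all add: assms)
  then show "\<exists>N. \<forall>k\<ge>N. Re (tr ((exp (inverse (2 ^ k) *\<^sub>R A) * exp (inverse (2 ^ k) *\<^sub>R B)) ^ 2 ^ k))
      \<le> Re (tr (exp A * exp B))"
    by (simp add: exp_scaleR_inverse_power2)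
qed

section \<open>The spectral theorem for self-adjoint matrices\<close>

text \<open>The Hermitian inner product, conjugate-linear in the first argument. The class operation
  \<open>\<bullet>\<close> on \<open>complex^'d\<close> is only its real part, which does not
  express complex orthogonality.\<close>

definition cip :: "complex^'d \<Rightarrow> complex^'d \<Rightarrow> complex" where
  "cip x y = (\<Sum>i\<in>UNIV. cnj (x $ i) * y $ i)"

lemma Re_cip: "Re (cip x y) = x \<bullet> y"
  by (simp add: cip_def inner_vec_def inner_complex_def)

lemma cip_add_right: "cip x (y + z) = cip x y + cip x z"
  and cip_diff_right: "cip x (y - z) = cip x y - cip x z"
  and cip_smult_right: "cip x (c *s y) = c * cip x y"
  and cip_scaleR_right: "cip x (r *\<^sub>R y) = r *\<^sub>R cip x y"
  and cip_zero_right [simp]: "cip x 0 = 0"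
  and cnj_cip: "cnj (cip x y) = cip y x"
  by (simp_all add: cip_def algebra_simps sum.distrib sum_subtractf sum_distrib_left scaleR_sum_right)

lemma cip_sum_right: "cip x (sum f I) = (\<Sum>i\<in>I. cip x (f i))"
  by (induction I rule: infinite_finite_induct) (auto simp: cip_add_right)

lemma cip_self: "cip x x = of_real ((norm x)\<^sup>2)"
proof (rule complex_eqI)
  show "Re (cip x x) = Re (of_real ((norm x)\<^sup>2))"
    by (simp add: Re_cip power2_norm_eq_inner)
  show "Im (cip x x) = Im (of_real ((norm x)\<^sup>2))"
    using cnj_cip[of x x] by (simp add: complex_eq_iff)
qed

lemma cip_mat_mult_vec: "cip x (A *v y) = cip (mat_adj A *v x) y"
proof -
  have "cip x (A *v y) = (\<Sum>i\<in>UNIV. \<Sum>j\<in>UNIV. cnj (x $ i) * (A $ i $ j * y $ j))"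
    by (simp add: cip_def matrix_vector_mult_def sum_distrib_left)
  also have "\<dots> = (\<Sum>j\<in>UNIV. \<Sum>i\<in>UNIV. cnj (x $ i) * (A $ i $ j * y $ j))"
    by (rule sum.swap)
  also have "\<dots> = cip (mat_adj A *v x) y"
    by (simp add: cip_def matrix_vector_mult_def mat_adj_def sum_distrib_left sum_distrib_right mult_ac)
  finally show ?thesis .
qed

lemma inner_mat_mult_vec: "x \<bullet> (A *v y) = (mat_adj A *v x) \<bullet> y"
  by (simp add: cip_mat_mult_vec flip: Re_cip)

lemma mat_mult_vec_scaleR: "A *v (c *\<^sub>R x) = c *\<^sub>R (A *v x)" for A :: "complex^'d^'d"
  by (rule linear_scale) simp

text \<open>The orthogonal complement \<open>W\<close> of a set of eigenvectors is invariant under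
  \<open>A\<close>, and \<open>v\<close> maximises the Rayleigh quotient on its unit sphere.
  Perturbing \<open>v\<close> in the direction of the residual
  \<open>u = A *v v - c *\<^sub>R v\<close> shows that \<open>u\<close> vanishes. The eigenvalue is
  real by construction.\<close>

lemma self_adjoint_eigenvector_in_orthogonal_complement:
  fixes A :: "complex^'d^'d"
  assumes "self_adjoint A"
    and inv: "\<And>s. s \<in> S \<Longrightarrow> \<exists>c::real. A *v s = c *\<^sub>R s"
    and "w \<noteq> 0" "\<forall>s\<in>S. cip s w = 0"
  obtains v and c :: real where "norm v = 1" "\<forall>s\<in>S. cip s v = 0" "A *v v = c *\<^sub>R v"
proof -
  define W where "W = {x. \<forall>s\<in>S. cip s x = 0}"
  have sa: "mat_adj A = A" using assms(1) by (simp add: self_adjoint_def)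
  have W_scale: "r *\<^sub>R x \<in> W" if "x \<in> W" for r x
    using that by (auto simp: W_def cip_scaleR_right)
  have W_add: "x + y \<in> W" if "x \<in> W" "y \<in> W" for x y
    using that by (auto simp: W_def cip_add_right)
  have W_A: "A *v x \<in> W" if "x \<in> W" for x
  proof -
    have "cip s (A *v x) = 0" if s: "s \<in> S" for s
    proof -
      obtain c where "A *v s = c *\<^sub>R s" using inv[OF s] by auto
      then have "cnj (cip s (A *v x)) = cip x (c *\<^sub>R s)"
        by (simp add: cip_mat_mult_vec sa cnj_cip)
      also have "\<dots> = c *\<^sub>R cnj (cip s x)" by (simp add: cip_scaleR_right cnj_cip)
      finally show ?thesis using \<open>x \<in> W\<close> s by (auto simp: W_def)
    qed
    then show ?thesis by (simp add: W_def)
  qed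
  have "closed W"
  proof -
    have "W = (\<Inter>s\<in>S. {x. cip s x = 0})" by (auto simp: W_def)
    moreover have "closed {x. cip s x = 0}" for s :: "complex^'d"
      unfolding cip_def by (intro closed_Collect_eq continuous_intros)
    ultimately show ?thesis by auto
  qed
  then have "compact (sphere 0 1 \<inter> W)" by (intro compact_Int_closed compact_sphere)
  moreover have "inverse (norm w) *\<^sub>R w \<in> sphere 0 1 \<inter> W"
    using assms(3,4) by (auto simp: W_def cip_scaleR_right)
  moreover have "continuous_on (sphere 0 1 \<inter> W) (\<lambda>x. x \<bullet> (A *v x))"
    by (intro continuous_intros)
  ultimately obtain v where v: "v \<in> sphere 0 1 \<inter> W"
    and max: "\<And>y. y \<in> sphere 0 1 \<inter> W \<Longrightarrow> y \<bullet> (A *v y) \<le> v \<bullet> (A *v v)"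
    using continuous_attains_sup[of "sphere 0 1 \<inter> W" "\<lambda>x. x \<bullet> (A *v x)"] by blast
  define c where "c = v \<bullet> (A *v v)"
  have le: "y \<bullet> (A *v y) \<le> c * (y \<bullet> y)" if "y \<in> W" for y
  proof (cases "y = 0")
    case False
    define z where "z = inverse (norm y) *\<^sub>R y"
    have "z \<bullet> (A *v z) \<le> c"
      unfolding c_def using that False by (intro max) (auto simp: z_def W_scale)
    moreover have "y \<bullet> (A *v y) = (norm y)\<^sup>2 * (z \<bullet> (A *v z))"
      using False by (simp add: z_def mat_mult_vec_scaleR power2_eq_square field_simps)
    ultimately show ?thesis
      by (simp add: mult.commute mult_right_mono flip: power2_norm_eq_inner)
  qed simp
  define u where "u = A *v v - c *\<^sub>R v"
  have vW: "v \<in> W" and nv: "v \<bullet> v = 1"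
    using v by (auto simp: norm_eq_1)
  have uW: "u \<in> W"
    using W_add[OF W_A[OF vW] W_scale[OF vW, of "- c"]] by (simp add: u_def)
  have uAv: "v \<bullet> (A *v u) = u \<bullet> (A *v v)"
    by (simp add: inner_mat_mult_vec[of v] sa inner_commute)
  define b where "b = u \<bullet> (A *v u) - c * (u \<bullet> u)"
  \<comment> \<open>The maximality of \<open>c\<close>, tested at \<open>v + t *\<^sub>R u\<close>.
    The terms of order zero cancel, and the linear coefficient is \<open>2 * (u \<bullet> u)\<close>
    because \<open>u \<bullet> (A *v v) = u \<bullet> u + c * (u \<bullet> v)\<close>.\<close>
  have quad: "2 * t * (u \<bullet> u) + t\<^sup>2 * b \<le> 0" for t
  proof -
    have "(v + t *\<^sub>R u) \<bullet> (A *v (v + t *\<^sub>R u)) \<le> c * ((v + t *\<^sub>R u) \<bullet> (v + t *\<^sub>R u))"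
      by (intro le W_add vW W_scale uW)
    then have "c + 2 * t * (u \<bullet> (A *v v)) + t\<^sup>2 * (u \<bullet> (A *v u))
        \<le> c * (1 + 2 * t * (u \<bullet> v) + t\<^sup>2 * (u \<bullet> u))"
      using nv uAv
      by (simp add: mat_mult_vec_scaleR matrix_vector_right_distrib inner_add_left inner_add_right
          c_def[symmetric] inner_commute[of v u] power2_eq_square algebra_simps)
    moreover have "u \<bullet> (A *v v) = u \<bullet> u + c * (u \<bullet> v)"
      by (subst (3) u_def) (simp add: inner_diff_right)
    ultimately show ?thesis by (simp only: b_def) (simp add: algebra_simps)
  qed
  have "u = 0"
  proof (rule ccontr)
    assume "u \<noteq> 0"
    then have pos: "u \<bullet> u > 0" by simp
    \<comment> \<open>Small enough that \<open>t * b\<close> is at most \<open>u \<bullet> u\<close>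
      in modulus and cannot cancel the linear term; the 1 in the denominator covers
      \<open>b = 0\<close>.\<close>
    define t where "t = (u \<bullet> u) / (\<bar>b\<bar> + 1)"
    have t: "t > 0" using pos by (simp add: t_def)
    have "t * (2 * (u \<bullet> u) + t * b) \<le> 0"
      using quad[of t] by (simp add: algebra_simps power2_eq_square)
    then have "2 * (u \<bullet> u) + t * b \<le> 0" using t by (simp add: mult_le_0_iff)
    moreover have "\<bar>t * b\<bar> \<le> u \<bullet> u"
      using pos by (simp add: t_def abs_mult field_simps)
    ultimately show False using pos by linarith
  qed
  then have "A *v v = c *\<^sub>R v" by (simp add: u_def)
  with v show thesis by (intro that[of v c]) (auto simp: W_def)
qed

text \<open>Induction on the number of eigenvectors: fewer than \<open>CARD('d)\<close> of them do
  not span, so a vector outside the span, minus its projection, is a nonzero element of the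
  complement, where a further eigenvector exists.\<close>

lemma self_adjoint_orthonormal_eigenvectors:
  fixes A :: "complex^'d^'d"
  assumes "self_adjoint A" "k \<le> CARD('d)"
  shows "\<exists>S. finite S \<and> card S = k \<and> (\<forall>s\<in>S. norm s = 1) \<and>
    (\<forall>s\<in>S. \<forall>s'\<in>S. s \<noteq> s' \<longrightarrow> cip s s' = 0) \<and> (\<forall>s\<in>S. \<exists>c::real. A *v s = c *\<^sub>R s)"
  using assms(2)
proof (induction k)
  case 0
  show ?case by (rule exI[of _ "{}"]) simp
next
  case (Suc k)
  then obtain S where S: "finite S" "card S = k" "\<forall>s\<in>S. norm s = 1"
    "\<forall>s\<in>S. \<forall>s'\<in>S. s \<noteq> s' \<longrightarrow> cip s s' = 0" "\<forall>s\<in>S. \<exists>c::real. A *v s = c *\<^sub>R s"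
    by auto
  have "vec.span S \<noteq> UNIV"
  proof
    assume "vec.span S = UNIV"
    then have "vec.dim (UNIV :: (complex^'d) set) \<le> card S"
      using S(1) by (intro vec.dim_le_card) auto
    then show False using Suc.prems S(2) by (simp add: vec.dim_UNIV card_cart_basis)
  qed
  then obtain x where x: "x \<notin> vec.span S" by blast
  define w where "w = x - (\<Sum>s\<in>S. cip s x *s s)"
  have "w \<noteq> 0"
  proof
    assume "w = 0"
    then have "x = (\<Sum>s\<in>S. cip s x *s s)" by (simp add: w_def)
    also have "\<dots> \<in> vec.span S" by (intro vec.span_sum vec.span_scale vec.span_base)
    finally show False using x by simp
  qed
  moreover have "cip s w = 0" if "s \<in> S" for s
  proof -
    have "(\<Sum>s'\<in>S. cip s' x * cip s s') = (\<Sum>s'\<in>S. if s' = s then cip s x else 0)"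
      using that S by (intro sum.cong) (auto simp: cip_self)
    then show ?thesis
      using that S(1) by (simp add: w_def cip_diff_right cip_sum_right cip_smult_right)
  qed
  ultimately obtain v and c :: real
    where v: "norm v = 1" "\<forall>s\<in>S. cip s v = 0" "A *v v = c *\<^sub>R v"
    using self_adjoint_eigenvector_in_orthogonal_complement[OF assms(1), of S w] S(5) by metis
  have "v \<notin> S" using v by (auto simp: cip_self)
  moreover have "\<forall>s\<in>S. cip v s = 0" using v(2) by (metis cnj_cip complex_cnj_zero)
  ultimately show ?case
    using S v by (intro exI[of _ "insert v S"]) auto
qed

theorem self_adjoint_diagonalisable:
  fixes A :: "complex^'d^'d"
  assumes "self_adjoint A"
  obtains U l where "unitary_mat U" "A = U ** diag_mat l ** mat_adj U"
proof -
  obtain S where S: "finite S" "card S = CARD('d)" "\<forall>s\<in>S. norm s = 1"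
    "\<forall>s\<in>S. \<forall>s'\<in>S. s \<noteq> s' \<longrightarrow> cip s s' = 0" "\<forall>s\<in>S. \<exists>c::real. A *v s = c *\<^sub>R s"
    using self_adjoint_orthonormal_eigenvectors[OF assms order_refl] by blast
  obtain b where b: "bij_betw b (UNIV :: 'd set) S"
    using S(1,2) by (metis finite_class.finite_UNIV finite_same_card_bij)
  then have bS: "b i \<in> S" for i by (auto simp: bij_betw_def)
  have "\<forall>i. \<exists>c::real. A *v b i = c *\<^sub>R b i" using S(5) bS by blast
  then obtain l :: "'d \<Rightarrow> real" where "\<forall>i. A *v b i = l i *\<^sub>R b i"
    by (rule choice[THEN exE])
  then have l: "A *v b i = l i *\<^sub>R b i" for i by blast
  define U :: "complex^'d^'d" where "U = (\<chi> i j. b j $ i)"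
  have orth: "cip (b i) (b j) = (if i = j then 1 else 0)" for i j
    using S(3,4) bS b by (auto simp: cip_self bij_betw_def inj_eq)
  have UU: "mat_adj U ** U = mat 1"
    using orth by (simp add: vec_eq_iff matrix_matrix_mult_def mat_adj_def U_def mat_def flip: cip_def)
  then have UU': "U ** mat_adj U = mat 1" using matrix_left_right_inverse by blast
  have "A ** U = U ** diag_mat l"
  proof -
    have "(A ** U) $ i $ j = (A *v b j) $ i" for i j
      by (simp add: matrix_matrix_mult_def matrix_vector_mult_def U_def)
    moreover have "(U ** diag_mat l) $ i $ j = l j *\<^sub>R b j $ i" for i j
      by (simp add: matrix_matrix_mult_def diag_mat_def U_def scaleR_conv_of_real
          if_distrib [where f="\<lambda>x. _ * x"] cong: if_cong)
    ultimately show ?thesis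
      by (simp add: vec_eq_iff l)
  qed
  then have "A = U ** diag_mat l ** mat_adj U"
    by (metis UU' matrix_mul_assoc matrix_mul_rid)
  with UU UU' show thesis by (intro that) (auto simp: unitary_mat_def)
qed

section \<open>Spectral calculus\<close>

definition unitary :: "'d::finite cmat \<Rightarrow> bool" where
  "unitary U \<longleftrightarrow> U * adj U = 1 \<and> adj U * U = 1"

definition dg :: "('d \<Rightarrow> real) \<Rightarrow> 'd::finite cmat" where
  "dg l = Cmat (diag_mat l)"

lemma entry_dg: "entry (dg l) i j = (if i = j then of_real (l i) else 0)"
  by (simp add: dg_def entry.abs_eq diag_mat_def)

lemma unitary_Cmat: "unitary (Cmat U) \<longleftrightarrow> unitary_mat U"
  unfolding unitary_def unitary_mat_def
  by (simp add: adj.abs_eq times_cmat.abs_eq one_cmat.abs_eq Cmat_inject)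

lemma Cmat_diagonalised:
  "Cmat (U ** diag_mat l ** mat_adj U) = Cmat U * dg l * adj (Cmat U)"
  by (simp add: dg_def adj.abs_eq times_cmat.abs_eq)

lemma self_adjoint_iff: "self_adjoint A \<longleftrightarrow> adj (Cmat A) = Cmat A"
  by (simp add: self_adjoint_def adj.abs_eq Cmat_inject)

lemma adj_eq_diagonalisable:
  assumes "adj A = A"
  obtains U l where "unitary U" "A = U * dg l * adj U"
proof -
  have "self_adjoint (mat_of A)" using assms by (simp add: self_adjoint_iff mat_of_inverse)
  then obtain U l where "unitary_mat U" "mat_of A = U ** diag_mat l ** mat_adj U"
    by (rule self_adjoint_diagonalisable)
  then have "unitary (Cmat U)" "A = Cmat U * dg l * adj (Cmat U)"
    by (simp add: unitary_Cmat, metis Cmat_diagonalised mat_of_inverse)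
  then show thesis by (rule that)
qed

lemma dg_mult: "dg l * dg m = dg (\<lambda>i. l i * m i)"
  by (rule cmat_eqI)
    (simp add: entry_mult entry_dg if_distrib [where f="\<lambda>x. _ * x"] cong: if_cong)

lemma dg_one: "dg (\<lambda>i. 1) = 1"
  and dg_zero: "dg (\<lambda>i. 0) = 0"
  and dg_add: "dg l + dg m = dg (\<lambda>i. l i + m i)"
  and dg_scaleR: "c *\<^sub>R dg l = dg (\<lambda>i. c * l i)"
  and adj_dg [simp]: "adj (dg l) = dg l"
  by (rule cmat_eqI, simp add: entry_dg entry_one scaleR_conv_of_real [where 'a=complex])+

lemma dg_power: "dg l ^ n = dg (\<lambda>i. l i ^ n)"
  by (induction n) (simp_all add: dg_mult dg_one)

lemma dg_sum: "finite I \<Longrightarrow> (\<Sum>k\<in>I. dg (l k)) = dg (\<lambda>i. \<Sum>k\<in>I. l k i)"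
  by (induction I rule: finite_induct) (simp_all add: dg_add dg_zero)

lemma exp_dg: "exp (dg l) = dg (\<lambda>i. exp (l i))"
proof (rule cmat_eqI)
  fix i j
  have "(\<lambda>n. dg l ^ n /\<^sub>R fact n) sums exp (dg l)" by (rule exp_converges)
  then have "(\<lambda>n. entry (dg l ^ n /\<^sub>R fact n) i j) sums entry (exp (dg l)) i j"
    by (rule bounded_linear.sums[OF bounded_linear_entry])
  moreover have "(\<lambda>n. entry (dg l ^ n /\<^sub>R fact n) i j) sums entry (dg (\<lambda>i. exp (l i))) i j"
  proof (cases "i = j")
    case True
    have "(\<lambda>n. complex_of_real (l i ^ n /\<^sub>R fact n)) sums complex_of_real (exp (l i))"
      by (intro sums_of_real exp_converges)
    then show ?thesis using True by (simp add: dg_power entry_dg scaleR_conv_of_real [where 'a=complex])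
  qed (simp add: dg_power entry_dg)
  ultimately show "entry (exp (dg l)) i j = entry (dg (\<lambda>i. exp (l i))) i j"
    by (rule sums_unique2)
qed

lemma unitary_cancel:
  assumes "unitary U"
  shows "U * (adj U * X) = X" "adj U * (U * X) = X"
  using assms by (simp_all add: unitary_def flip: mult.assoc)

lemma unitary_conj_power: "unitary U \<Longrightarrow> (U * A * adj U) ^ n = U * A ^ n * adj U"
proof (induction n)
  case (Suc n)
  have "(U * A * adj U) ^ Suc n = U * A * (adj U * U) * A ^ n * adj U"
    using Suc by (simp add: mult.assoc)
  then show ?case using Suc.prems by (simp add: mult.assoc unitary_cancel)
qed (simp add: unitary_def)

lemma unitary_conj_exp: "unitary U \<Longrightarrow> exp (U * A * adj U) = U * exp A * adj U"
proof -
  assume U: "unitary U"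
  have "bounded_linear (\<lambda>X. U * X * adj U)"
    by (intro bounded_linear_intros)
  then have "(\<lambda>n. U * (A ^ n /\<^sub>R fact n) * adj U) sums (U * exp A * adj U)"
    by (rule bounded_linear.sums[OF _ exp_converges])
  then have "(\<lambda>n. (U * A * adj U) ^ n /\<^sub>R fact n) sums (U * exp A * adj U)"
    by (simp add: unitary_conj_power[OF U])
  then show ?thesis using sums_unique2 exp_converges by blast
qed

lemma exp_diagonalised:
  "unitary U \<Longrightarrow> exp (U * dg l * adj U) = U * dg (\<lambda>i. exp (l i)) * adj U"
  by (simp add: unitary_conj_exp exp_dg)

lemma tr_unitary_conj: "unitary U \<Longrightarrow> tr (U * A * adj U) = tr A"
  by (metis mult.assoc mult_1_right tr_mult_commute unitary_def)

lemma tr_dg: "tr (dg l) = of_real (\<Sum>i\<in>UNIV. l i)"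
  by (simp add: tr_def entry_dg)

lemma unitary_row_sum:
  assumes "unitary U"
  shows "(\<Sum>j\<in>UNIV. (norm (entry U i j))\<^sup>2) = 1"
proof -
  have "complex_of_real (\<Sum>j\<in>UNIV. (norm (entry U i j))\<^sup>2) = entry (U * adj U) i i"
    by (simp only: entry_mult entry_adj of_real_sum complex_norm_square)
  also have "\<dots> = of_real 1" using assms by (simp add: unitary_def entry_one)
  finally show ?thesis by (simp only: of_real_eq_iff)
qed

lemma unitary_adj: "unitary U \<Longrightarrow> unitary (adj U)"
  by (simp add: unitary_def)

lemma unitary_mult: "unitary U \<Longrightarrow> unitary V \<Longrightarrow> unitary (U * V)"
  unfolding unitary_def[of "U * V"]
  by (simp add: mult.assoc unitary_cancel) (simp add: unitary_def)

lemma unitary_column_sum: "unitary U \<Longrightarrow> (\<Sum>i\<in>UNIV. (norm (entry U i j))\<^sup>2) = 1"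
  using unitary_row_sum[OF unitary_adj, of U j] by simp

text \<open>The weights are squared overlaps of the two eigenbases. For unitary \<open>U\<close> and
  \<open>V\<close> they form a doubly stochastic matrix, so traces of products of noncommuting
  matrices can be compared through scalar inequalities.\<close>

lemma tr_mult_diagonalised:
  "tr ((V * dg b * adj V) * (U * dg a * adj U))
    = of_real (\<Sum>j\<in>UNIV. \<Sum>i\<in>UNIV. b j * a i * (norm (entry (adj V * U) j i))\<^sup>2)"
proof -
  define S where "S = adj V * U"
  have "tr ((V * dg b * adj V) * (U * dg a * adj U)) = tr (V * (dg b * (S * dg a * adj U)))"
    by (simp add: S_def mult.assoc)
  also have "\<dots> = tr (dg b * (S * dg a) * adj S)"
    by (subst tr_mult_commute) (simp add: S_def mult.assoc)
  also have "\<dots> = (\<Sum>j\<in>UNIV. \<Sum>i\<in>UNIV. of_real (b j) * (entry S j i * of_real (a i)) * cnj (entry S j i))"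
    by (simp add: tr_def entry_mult entry_dg if_distrib [where f="\<lambda>x. _ * x"]
        if_distrib [where f="\<lambda>x. x * _"] sum_distrib_left cong: if_cong)
  also have "\<dots> = of_real (\<Sum>j\<in>UNIV. \<Sum>i\<in>UNIV. b j * a i * (norm (entry S j i))\<^sup>2)"
    by (simp only: of_real_sum of_real_mult complex_norm_square mult_ac)
  finally show ?thesis by (simp add: S_def)
qed

text \<open>In the eigenbases of \<open>B\<close> and \<open>B + C\<close> this is \<open>exp a \<ge> exp b * (1 + a - b)\<close>, averaged with
  a doubly stochastic matrix.\<close>

lemma tr_exp_tangent:
  assumes B: "adj B = B" and C: "adj C = C"
  shows "Re (tr (exp B * (1 + C))) \<le> Re (tr (exp (B + C)))"
proof -
  obtain V b where V: "unitary V" and Bd: "B = V * dg b * adj V"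
    by (rule adj_eq_diagonalisable[OF B])
  obtain U a where U: "unitary U" and Ad: "B + C = U * dg a * adj U"
    by (rule adj_eq_diagonalisable[of "B + C"]) (simp_all add: B C)
  define p where "p j i = (norm (entry (adj V * U) j i))\<^sup>2" for j i
  have VU: "unitary (adj V * U)" using U V by (simp add: unitary_adj unitary_mult)
  have p1: "(\<Sum>i\<in>UNIV. p j i) = 1" for j unfolding p_def by (rule unitary_row_sum[OF VU])
  have p2: "(\<Sum>j\<in>UNIV. p j i) = 1" for i unfolding p_def by (rule unitary_column_sum[OF VU])
  have expB: "exp B = V * dg (\<lambda>i. exp (b i)) * adj V" by (simp add: Bd exp_diagonalised V)
  \<comment> \<open>\<open>C\<close> is eliminated in favour of \<open>B\<close> and
    \<open>B + C\<close>, the two matrices whose eigenbases are at hand.\<close>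
  have "exp B * (1 + C) = exp B * (1 - B) + exp B * (B + C)" by (simp add: algebra_simps)
  also have "exp B * (1 - B) = V * (dg (\<lambda>i. exp (b i)) * (1 - dg b)) * adj V"
    unfolding expB unfolding Bd by (simp add: algebra_simps unitary_cancel[OF V])
  also have "1 - dg b = dg (\<lambda>i. 1 - b i)"
    using dg_add[of "\<lambda>i. 1 - b i" b] by (simp add: dg_one algebra_simps)
  also have "tr (V * (dg (\<lambda>i. exp (b i)) * \<dots>) * adj V + exp B * (B + C))
      = of_real (\<Sum>j\<in>UNIV. exp (b j) * (1 - b j)) +
        of_real (\<Sum>j\<in>UNIV. \<Sum>i\<in>UNIV. exp (b j) * a i * p j i)"
    unfolding tr_add tr_unitary_conj[OF V] dg_mult tr_dg expB Ad tr_mult_diagonalised p_def ..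
  also have "(\<Sum>j\<in>UNIV. exp (b j) * (1 - b j)) = (\<Sum>j\<in>UNIV. \<Sum>i\<in>UNIV. exp (b j) * (1 - b j) * p j i)"
    by (simp add: p1 flip: sum_distrib_left)
  finally have lhs: "Re (tr (exp B * (1 + C))) = (\<Sum>j\<in>UNIV. \<Sum>i\<in>UNIV. exp (b j) * (1 + (a i - b j)) * p j i)"
    by (simp add: algebra_simps flip: sum.distrib)
  have "Re (tr (exp (B + C))) = (\<Sum>i\<in>UNIV. \<Sum>j\<in>UNIV. exp (a i) * p j i)"
    by (simp add: Ad exp_diagonalised[OF U] tr_unitary_conj[OF U] tr_dg p2 flip: sum_distrib_left)
  also have "\<dots> = (\<Sum>j\<in>UNIV. \<Sum>i\<in>UNIV. exp (a i) * p j i)" by (rule sum.swap)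
  finally have rhs: "Re (tr (exp (B + C))) = \<dots>" .
  have "exp (b j) * (1 + (a i - b j)) \<le> exp (a i)" for i j
  proof -
    have "exp (b j) * (1 + (a i - b j)) \<le> exp (b j) * exp (a i - b j)"
      by (intro mult_left_mono exp_ge_add_one_self) simp
    then show ?thesis by (simp flip: exp_add)
  qed
  then show ?thesis unfolding lhs rhs
    by (intro sum_mono mult_right_mono) (simp_all add: p_def)
qed

text \<open>Entries of a unitary matrix have modulus at most 1, and the eigenvalues of the
  exponential are positive. The bound lets integrability of the trace pass to the individual
  entries.\<close>

lemma norm_entry_exp_le_tr:
  assumes "adj A = A"
  shows "norm (entry (exp A) i j) \<le> Re (tr (exp A))"
proof -
  obtain U l where U: "unitary U" and Ad: "A = U * dg l * adj U"
    by (rule adj_eq_diagonalisable[OF assms])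
  have U1: "norm (entry U i k) \<le> 1" for i k
  proof -
    have "(norm (entry U i k))\<^sup>2 \<le> (\<Sum>k\<in>UNIV. (norm (entry U i k))\<^sup>2)"
      by (rule member_le_sum) auto
    then show ?thesis by (simp add: unitary_row_sum[OF U] power_le_one_iff)
  qed
  have "entry (exp A) i j = (\<Sum>k\<in>UNIV. entry U i k * of_real (exp (l k)) * cnj (entry U j k))"
    by (simp add: Ad exp_diagonalised[OF U] entry_mult entry_dg if_distrib [where f="\<lambda>x. _ * x"] cong: if_cong)
  also have "norm \<dots> \<le> (\<Sum>k\<in>UNIV. norm (entry U i k * of_real (exp (l k)) * cnj (entry U j k)))"
    by (rule norm_sum)
  also have "\<dots> \<le> (\<Sum>k\<in>UNIV. 1 * exp (l k) * 1)"
    unfolding norm_mult by (intro sum_mono mult_mono) (auto simp: U1)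
  also have "\<dots> = Re (tr (exp A))"
    by (simp add: Ad exp_diagonalised[OF U] tr_unitary_conj[OF U] tr_dg)
  finally show ?thesis .
qed

section \<open>Quadratic forms and extreme eigenvalues\<close>

text \<open>The real part of the Hermitian form of \<open>A\<close> at \<open>x\<close>. Order
  relations between self-adjoint matrices are expressed through it, one vector at a time.\<close>

definition qf :: "complex^'d \<Rightarrow> 'd::finite cmat \<Rightarrow> real" where
  "qf x A = x \<bullet> (mat_of A *v x)"

lemma qf_add: "qf x (A + B) = qf x A + qf x B"
  and qf_diff: "qf x (A - B) = qf x A - qf x B"
  and qf_minus: "qf x (- A) = - qf x A"
  and qf_zero [simp]: "qf x 0 = 0"
  and qf_scaleR: "qf x (c *\<^sub>R A) = c * qf x A"
proof -
  show "qf x (A + B) = qf x A + qf x B"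
    by (simp add: qf_def plus_cmat.rep_eq matrix_vector_mult_add_rdistrib inner_add_right)
  show "qf x (c *\<^sub>R A) = c * qf x A" for c A
    by (simp add: qf_def scaleR_cmat.rep_eq scaleR_mat_mult_vec)
  from this[of "-1" A] show "qf x (- A) = - qf x A" by simp
  show "qf x (A - B) = qf x A - qf x B"
    by (simp add: qf_def minus_cmat.rep_eq matrix_vector_mult_diff_rdistrib inner_diff_right)
  show "qf x 0 = 0" by (simp add: qf_def zero_cmat.rep_eq)
qed

lemma qf_sum: "qf x (sum f I) = (\<Sum>i\<in>I. qf x (f i))"
  by (induction I rule: infinite_finite_induct) (simp_all add: qf_add)

lemma qf_le_norm: "norm x = 1 \<Longrightarrow> qf x A \<le> norm A"
proof -
  assume x: "norm x = 1"
  have "qf x A \<le> norm x * norm (mat_of A *v x)"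
    unfolding qf_def by (rule norm_cauchy_schwarz)
  also have "\<dots> \<le> norm A"
    using norm_mat_mult_vec_le[of "mat_of A" x] x by (simp add: norm_cmat.rep_eq)
  finally show ?thesis .
qed

lemma qf_mult_dg: "qf x (U * dg l * adj U) = (\<Sum>i\<in>UNIV. l i * (norm ((mat_of (adj U) *v x) $ i))\<^sup>2)"
proof -
  let ?y = "mat_of (adj U) *v x"
  have "qf x (U * dg l * adj U) = x \<bullet> (mat_of U *v (diag_mat l *v ?y))"
    by (simp add: qf_def dg_def times_cmat.rep_eq Cmat_inverse matrix_vector_mul_assoc matrix_mul_assoc)
  also have "\<dots> = ?y \<bullet> (diag_mat l *v ?y)"
    by (simp add: inner_mat_mult_vec[of x] adj.rep_eq)
  also have "diag_mat l *v ?y = (\<chi> i. l i *\<^sub>R ?y $ i)"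
    by (simp add: vec_eq_iff matrix_vector_mult_def diag_mat_def scaleR_conv_of_real
        if_distrib [where f="\<lambda>x. x * _"] cong: if_cong)
  also have "?y \<bullet> \<dots> = (\<Sum>i\<in>UNIV. l i * (norm (?y $ i))\<^sup>2)"
    by (simp add: inner_vec_def power2_norm_eq_inner)
  finally show ?thesis .
qed

lemma unitary_coordinates_sum:
  assumes "unitary U"
  shows "(\<Sum>i\<in>UNIV. (norm ((mat_of (adj U) *v x) $ i))\<^sup>2) = (norm x)\<^sup>2"
proof -
  have "(\<Sum>i\<in>UNIV. (norm ((mat_of (adj U) *v x) $ i))\<^sup>2) = qf x (U * dg (\<lambda>i. 1) * adj U)"
    by (simp add: qf_mult_dg)
  also have "\<dots> = (norm x)\<^sup>2"
    using assms by (simp add: dg_one unitary_def qf_def one_cmat.rep_eq power2_norm_eq_inner)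
  finally show ?thesis .
qed

text \<open>The form at a unit vector is a weighted mean of the eigenvalues, so some eigenvalue is
  at least as large, and its exponential is one of the positive summands of the trace.\<close>

lemma exp_le_tr_exp:
  assumes "adj A = A" "norm x = 1"
  shows "exp (qf x A) \<le> Re (tr (exp A))"
proof -
  obtain U l where U: "unitary U" and Ad: "A = U * dg l * adj U"
    by (rule adj_eq_diagonalisable[OF assms(1)])
  define w where "w i = (norm ((mat_of (adj U) *v x) $ i))\<^sup>2" for i
  have w: "(\<Sum>i\<in>UNIV. w i) = 1" "\<And>i. 0 \<le> w i"
    using unitary_coordinates_sum[OF U, of x] assms(2) by (simp_all add: w_def)
  obtain i where "qf x A \<le> l i"
  proof (rule ccontr)
    assume "\<not> thesis"
    then have lt: "l i < qf x A" for i using that by (meson not_le)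
    obtain k where "w k \<noteq> 0" using w(1) by force
    then have "(\<Sum>i\<in>UNIV. l i * w i) < (\<Sum>i\<in>UNIV. qf x A * w i)"
      using lt w(2) by (intro sum_strict_mono_ex1) (auto simp: less_le intro!: mult_right_mono bexI[of _ k])
    also have "\<dots> = qf x A" by (simp add: w flip: sum_distrib_left)
    finally show False by (simp add: Ad qf_mult_dg w_def)
  qed
  then have "exp (qf x A) \<le> exp (l i)" by simp
  also have "\<dots> \<le> (\<Sum>i\<in>UNIV. exp (l i))" by (rule member_le_sum) auto
  also have "\<dots> = Re (tr (exp A))"
    by (simp add: Ad exp_diagonalised[OF U] tr_unitary_conj[OF U] tr_dg)
  finally show ?thesis .
qed

text \<open>The witness is a unit eigenvector for an eigenvalue of largest modulus. An operator norm
  bound thus splits into an upper and a lower bound on the quadratic form.\<close>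

lemma adj_eq_norm_attained:
  assumes "adj A = A"
  obtains x where "norm x = 1" "\<bar>qf x A\<bar> \<ge> norm A"
proof -
  obtain U l where U: "unitary U" and Ad: "A = U * dg l * adj U"
    by (rule adj_eq_diagonalisable[OF assms])
  obtain k where k: "\<And>i. \<bar>l i\<bar> \<le> \<bar>l k\<bar>"
  proof -
    have "Max (range (\<lambda>i. \<bar>l i\<bar>)) \<in> range (\<lambda>i. \<bar>l i\<bar>)" by (intro Max_in) auto
    then obtain k where "\<bar>l k\<bar> = Max (range (\<lambda>i. \<bar>l i\<bar>))" by (metis imageE)
    then have "\<bar>l i\<bar> \<le> \<bar>l k\<bar>" for i by simp
    then show thesis by (rule that)
  qed
  have "norm A \<le> \<bar>l k\<bar>"
    unfolding norm_cmat.rep_eq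
  proof (rule op_norm_le, rule power2_le_imp_le)
    fix x
    have "(norm (mat_of A *v x))\<^sup>2 = qf x (adj A * A)"
      by (simp add: qf_def times_cmat.rep_eq adj.rep_eq power2_norm_eq_inner inner_mat_mult_vec
          flip: matrix_vector_mul_assoc) (simp add: assms flip: adj.rep_eq)
    also have "adj A * A = U * dg (\<lambda>i. l i * l i) * adj U"
      by (simp add: Ad mult.assoc unitary_cancel[OF U] flip: dg_mult)
    also have "qf x \<dots> \<le> (\<Sum>i\<in>UNIV. (l k)\<^sup>2 * (norm ((mat_of (adj U) *v x) $ i))\<^sup>2)"
      unfolding qf_mult_dg power2_eq_square[symmetric] using k by (intro sum_mono mult_right_mono) (auto simp: abs_le_square_iff)
    also have "\<dots> = (\<bar>l k\<bar> * norm x)\<^sup>2"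
      by (simp add: unitary_coordinates_sum[OF U] power_mult_distrib flip: sum_distrib_left)
    finally show "(norm (mat_of A *v x))\<^sup>2 \<le> (\<bar>l k\<bar> * norm x)\<^sup>2" .
  qed simp
  moreover define x where "x = mat_of U *v axis k 1"
  have x: "mat_of (adj U) *v x = axis k 1"
    using U by (simp add: x_def unitary_def matrix_vector_mul_assoc flip: times_cmat.rep_eq)
      (simp add: one_cmat.rep_eq)
  have "qf x A = (\<Sum>i\<in>UNIV. if i = k then l i else 0)"
    unfolding Ad qf_mult_dg x by (intro sum.cong) (auto simp: axis_def)
  then have "qf x A = l k" by simp
  moreover have "(norm x)\<^sup>2 = (\<Sum>i\<in>UNIV. if i = k then 1 else 0)"
    unfolding unitary_coordinates_sum[OF U, symmetric] x by (intro sum.cong) (auto simp: axis_def)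
  then have "norm x = 1" by (simp add: power2_eq_1_iff) (smt (verit) norm_ge_zero)
  ultimately show thesis by (intro that[of x]) auto
qed

section \<open>Measurability of the spectral calculus\<close>

text \<open>Resolves the choice in \<open>mat_fun\<close>: one diagonalisation serves both
  \<open>A\<close> and its image, and the scalar bounds on \<open>f\<close> are later applied in
  that eigenbasis.\<close>

lemma mat_fun_diagonalised:
  assumes "self_adjoint A"
  obtains U l where "unitary_mat U" "A = U ** diag_mat l ** mat_adj U"
    "mat_fun f A = U ** diag_mat (\<lambda>i. f (l i)) ** mat_adj U"
proof -
  have "\<exists>B U l. unitary_mat U \<and> A = U ** diag_mat l ** mat_adj U
      \<and> B = U ** diag_mat (\<lambda>i. f (l i)) ** mat_adj U"
    using self_adjoint_diagonalisable[OF assms] by metis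
  from someI_ex[OF this] show thesis
    unfolding mat_fun_def[symmetric] using that by blast
qed

lemma continuous_on_Cmat: "continuous_on S (Cmat :: complex^'d^'d \<Rightarrow> 'd::finite cmat)"
  unfolding continuous_on_def tendsto_cmat_iff
  by (auto simp: entry.abs_eq intro!: tendsto_intros)

lemma entry_mat_of: "entry A i j = mat_of A $ i $ j"
  by (simp add: entry.rep_eq)

lemma continuous_on_mat_of: "continuous_on S (mat_of :: 'd::finite cmat \<Rightarrow> complex^'d^'d)"
  unfolding continuous_on_def
proof (intro ballI vec_tendstoI)
  fix x :: "'d cmat" and i j
  show "((\<lambda>x. mat_of x $ i $ j) \<longlongrightarrow> mat_of x $ i $ j) (at x within S)"
    unfolding entry_mat_of[symmetric]
    by (intro bounded_linear.tendsto[OF bounded_linear_entry] tendsto_ident_at)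
qed

lemma Cmat_add: "Cmat (A + B) = Cmat A + Cmat B"
  and Cmat_diff: "Cmat (A - B) = Cmat A - Cmat B"
  and Cmat_scaleR: "Cmat (c *\<^sub>R A) = c *\<^sub>R Cmat A"
  and Cmat_zero: "Cmat 0 = 0"
  and Cmat_mult: "Cmat (A ** B) = Cmat A * Cmat B"
  by (simp_all add: plus_cmat.abs_eq minus_cmat.abs_eq scaleR_cmat.abs_eq zero_cmat_def times_cmat.abs_eq)

lemma Cmat_sum: "Cmat (sum f I) = (\<Sum>i\<in>I. Cmat (f i))"
  by (induction I rule: infinite_finite_induct) (simp_all add: Cmat_add Cmat_zero)

lemma norm_Cmat: "norm (Cmat A) = op_norm A"
  by (rule norm_cmat.abs_eq)

text \<open>The \<open>k\<close>-th polynomial approximates \<open>g\<close> within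
  \<open>1 / (k + 1)\<close> on the interval from \<open>-k\<close> to \<open>k\<close>; each point
  lies in all but finitely many of these intervals.\<close>

lemma pointwise_limit_of_polynomials:
  fixes g :: "real \<Rightarrow> real"
  assumes "continuous_on UNIV g"
  obtains a :: "nat \<Rightarrow> nat \<Rightarrow> real" and n :: "nat \<Rightarrow> nat"
  where "\<And>x. (\<lambda>k. \<Sum>i\<le>n k. a k i * x ^ i) \<longlonglongrightarrow> g x"
proof -
  have "\<exists>a n. \<forall>x\<in>cball 0 (real k). \<bar>g x - (\<Sum>i\<le>n. a i * x ^ i)\<bar> < inverse (real (Suc k))" for k
  proof -
    obtain p where "real_polynomial_function p"
      "\<And>x. x \<in> cball 0 (real k) \<Longrightarrow> \<bar>g x - p x\<bar> < inverse (real (Suc k))"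
      using Stone_Weierstrass_real_polynomial_function[of "cball 0 (real k)" g "inverse (real (Suc k))"]
        continuous_on_subset[OF assms, of "cball 0 (real k)"] by auto
    then show ?thesis unfolding real_polynomial_function_iff_sum by blast
  qed
  then obtain a n where an:
    "\<And>k x. x \<in> cball 0 (real k) \<Longrightarrow> \<bar>g x - (\<Sum>i\<le>n k. a k i * x ^ i)\<bar> < inverse (real (Suc k))"
    by metis
  have "(\<lambda>k. \<Sum>i\<le>n k. a k i * x ^ i) \<longlonglongrightarrow> g x" for x
  proof (rule LIM_zero_cancel, rule Lim_null_comparison[OF _ LIMSEQ_inverse_real_of_nat])
    obtain K where "\<bar>x\<bar> \<le> real K" using real_arch_simple by blast
    then have "\<forall>k\<ge>K. x \<in> cball 0 (real k)" by auto
    then show "\<forall>\<^sub>F k in sequentially. norm ((\<Sum>i\<le>n k. a k i * x ^ i) - g x) \<le> inverse (real (Suc k))"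
      using an unfolding eventually_sequentially
      by (metis abs_minus_commute less_imp_le real_norm_def)
  qed
  then show thesis by (rule that)
qed

text \<open>\<open>G A\<close> is a limit of polynomials in \<open>A\<close>; this gives both the measurability and the independence
  of the chosen diagonalisation.\<close>

lemma measurable_spectral_calculus:
  fixes g :: "real \<Rightarrow> real"
  assumes "continuous_on UNIV g"
  obtains G :: "complex^'d^'d \<Rightarrow> complex^'d^'d" where "G \<in> borel_measurable borel"
    "\<And>U l. unitary_mat U \<Longrightarrow>
      G (U ** diag_mat l ** mat_adj U) = U ** diag_mat (\<lambda>i. g (l i)) ** mat_adj U"
proof -
  obtain a :: "nat \<Rightarrow> nat \<Rightarrow> real" and n :: "nat \<Rightarrow> nat" where an: "\<And>x. (\<lambda>k. \<Sum>i\<le>n k. a k i * x ^ i) \<longlonglongrightarrow> g x"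
    using pointwise_limit_of_polynomials[OF assms] by blast
  define q :: "nat \<Rightarrow> complex^'d^'d \<Rightarrow> complex^'d^'d"
    where "q k A = mat_of (\<Sum>i\<le>n k. a k i *\<^sub>R Cmat A ^ i)" for k A
  have q: "q k \<in> borel_measurable borel" for k
    unfolding q_def
    by (intro borel_measurable_continuous_onI continuous_on_compose2[OF continuous_on_mat_of]
        continuous_intros continuous_on_Cmat) auto
  have lim: "(\<lambda>k. q k (U ** diag_mat l ** mat_adj U)) \<longlonglongrightarrow> U ** diag_mat (\<lambda>i. g (l i)) ** mat_adj U"
    if "unitary_mat U" for U l
  proof -
    let ?V = "Cmat U"
    have V: "unitary ?V" using that by (simp add: unitary_Cmat)
    have "a k i *\<^sub>R (?V * dg l * adj ?V) ^ i = ?V * dg (\<lambda>j. a k i * l j ^ i) * adj ?V" for k i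
      by (simp add: unitary_conj_power[OF V] dg_power flip: dg_scaleR)
    then have poly: "(\<Sum>i\<le>n k. a k i *\<^sub>R (?V * dg l * adj ?V) ^ i)
        = ?V * dg (\<lambda>j. \<Sum>i\<le>n k. a k i * l j ^ i) * adj ?V" for k
      by (simp add: dg_sum[symmetric] sum_distrib_left sum_distrib_right)
    have "(\<lambda>k. dg (\<lambda>j. \<Sum>i\<le>n k. a k i * l j ^ i)) \<longlonglongrightarrow> dg (\<lambda>j. g (l j))"
      unfolding tendsto_cmat_iff entry_dg using an
      by (auto simp del: of_real_sum of_real_mult of_real_power intro: tendsto_of_real)
    then have "(\<lambda>k. ?V * dg (\<lambda>j. \<Sum>i\<le>n k. a k i * l j ^ i) * adj ?V) \<longlonglongrightarrow> ?V * dg (\<lambda>j. g (l j)) * adj ?V"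
      by (intro tendsto_intros)
    then have "(\<lambda>k. mat_of (?V * dg (\<lambda>j. \<Sum>i\<le>n k. a k i * l j ^ i) * adj ?V))
        \<longlonglongrightarrow> mat_of (?V * dg (\<lambda>j. g (l j)) * adj ?V)"
      by (rule continuous_on_tendsto_compose[OF continuous_on_mat_of[of UNIV]]) auto
    then show ?thesis
      by (simp add: q_def Cmat_diagonalised poly) (simp add: Cmat_inverse flip: Cmat_diagonalised)
  qed
  show thesis
  proof (rule that)
    \<comment> \<open>\<open>lim\<close> is total, so this is measurable on all matrices, including
      those where the polynomials do not converge.\<close>
    show "(\<lambda>A. lim (\<lambda>k. q k A)) \<in> borel_measurable borel"
      using q by (rule borel_measurable_lim_metric)
  qed (use lim limI in blast)
qed

section \<open>The matrix Laplace transform\<close>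

text \<open>On a ball the series is dominated by a convergent scalar series, hence uniformly
  convergent. Continuity is what makes the entries of exponentials of random matrices
  measurable.\<close>

lemma isCont_exp_algebra:
  fixes x :: "'a::{real_normed_algebra_1,banach}"
  shows "isCont exp x"
proof -
  let ?B = "ball 0 (norm x + 1) :: 'a set"
  have "uniform_limit ?B (\<lambda>n y. \<Sum>i<n. y ^ i /\<^sub>R fact i) (\<lambda>y. \<Sum>i. y ^ i /\<^sub>R fact i) sequentially"
  proof (rule Weierstrass_m_test)
    show "norm (y ^ i /\<^sub>R fact i) \<le> (norm x + 1) ^ i /\<^sub>R fact i" if "y \<in> ?B" for i y
      using that by (simp add: mult_left_mono order_trans[OF norm_power_ineq] power_mono)
    show "summable (\<lambda>i. (norm x + 1) ^ i /\<^sub>R fact i)" by (rule summable_exp_generic)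
  qed
  then have "continuous_on ?B exp"
    unfolding exp_def
    by (rule uniform_limit_theorem[rotated]) (auto intro!: always_eventually continuous_intros)
  then show ?thesis by (simp add: continuous_on_eq_continuous_at)
qed

lemma continuous_on_exp_algebra:
  "continuous_on S f \<Longrightarrow> continuous_on S (\<lambda>x. exp (f x))"
  for f :: "_ \<Rightarrow> 'a::{real_normed_algebra_1,banach}"
  by (rule continuous_on_compose2[OF continuous_at_imp_continuous_on, of UNIV])
    (auto intro: isCont_exp_algebra)

lemma measurable_entry_exp [measurable]:
  "(\<lambda>A. entry (exp (Cmat A)) i j) \<in> borel_measurable borel"
  by (intro borel_measurable_continuous_onI continuous_on_compose2[OF
        linear_continuous_on[OF bounded_linear_entry], of UNIV] continuous_on_exp_algebra continuous_on_Cmat) auto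

lemma tr_exp_nonneg: "adj A = A \<Longrightarrow> 0 \<le> Re (tr (exp A))"
  using norm_entry_exp_le_tr[of A undefined undefined] norm_ge_zero by (rule order_trans[rotated])

text \<open>Golden--Thompson decouples \<open>Z i\<close> from the remaining sum; after taking expectations over
  \<open>Z i\<close> the tangent inequality absorbs the factor \<open>1 + C i\<close>. The statement is inductive because
  \<open>H\<close> is arbitrary.\<close>

lemma (in prob_space) expectation_tr_exp_sum_le:
  fixes Z :: "'i \<Rightarrow> 'a \<Rightarrow> complex^'d^'d" and C :: "'i \<Rightarrow> 'd cmat"
  assumes "finite I" and "indep_vars (\<lambda>_. borel) Z I"
    and "\<And>i \<omega>. i \<in> I \<Longrightarrow> \<omega> \<in> space M \<Longrightarrow> adj (Cmat (Z i \<omega>)) = Cmat (Z i \<omega>)"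
    and "\<And>i. i \<in> I \<Longrightarrow> adj (C i) = C i"
    and "\<And>i a b. i \<in> I \<Longrightarrow> integrable M (\<lambda>\<omega>. entry (exp (Cmat (Z i \<omega>))) a b)"
    and "\<And>i a b. i \<in> I \<Longrightarrow> expectation (\<lambda>\<omega>. entry (exp (Cmat (Z i \<omega>))) a b) = entry (1 + C i) a b"
    and "adj H = H"
  shows "integrable M (\<lambda>\<omega>. Re (tr (exp (H + (\<Sum>i\<in>I. Cmat (Z i \<omega>) - C i))))) \<and>
    expectation (\<lambda>\<omega>. Re (tr (exp (H + (\<Sum>i\<in>I. Cmat (Z i \<omega>) - C i))))) \<le> Re (tr (exp H))"
  using assms
proof (induction I arbitrary: H rule: finite_induct)
  case empty
  then show ?case by (simp add: prob_space)
next
  case (insert i I)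
  define D where "D H \<omega> = H + (\<Sum>j\<in>I. Cmat (Z j \<omega>) - C j)" for H \<omega>
  \<comment> \<open>The shift by \<open>C i\<close> is moved into the base matrix, so
    \<open>P\<close> depends only on the summands in \<open>I\<close> and is independent of
    \<open>Z i\<close>.\<close>
  define P where "P \<omega> = exp (D (H - C i) \<omega>)" for \<omega>
  define Q where "Q \<omega> = exp (Cmat (Z i \<omega>))" for \<omega>
  have meas [measurable]: "Z j \<in> borel_measurable M" if "j \<in> insert i I" for j
    using insert.prems(1) that unfolding indep_vars_def by auto
  \<comment> \<open>Used at two bases: at \<open>H - C i\<close> it supplies the integrability of
    \<open>P\<close>, at \<open>H\<close> the final bound.\<close>
  have IH: "integrable M (\<lambda>\<omega>. Re (tr (exp (D H \<omega>))))"
    "expectation (\<lambda>\<omega>. Re (tr (exp (D H \<omega>)))) \<le> Re (tr (exp H))" if "adj H = H" for H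
    using insert.IH[OF indep_vars_subset[OF insert.prems(1)] _ _ _ _ that] insert.prems
    by (auto simp: D_def)
  have Ci: "adj (C i) = C i" and Hi: "adj (H - C i) = H - C i" using insert.prems by auto
  have adjD: "adj (D H \<omega>) = D H \<omega>" if "\<omega> \<in> space M" "adj H = H" for H \<omega>
    using that insert.prems by (simp add: D_def)
  have D_Cmat: "D H \<omega> = Cmat (mat_of H + (\<Sum>j\<in>I. Z j \<omega> - mat_of (C j)))" for H \<omega>
    by (simp add: D_def Cmat_add Cmat_sum Cmat_diff mat_of_inverse)
  have P_meas [measurable]: "(\<lambda>\<omega>. entry (P \<omega>) a b) \<in> borel_measurable M" for a b
    unfolding P_def D_Cmat using meas by measurable
  have P_int: "integrable M (\<lambda>\<omega>. entry (P \<omega>) a b)" for a b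
    by (rule Bochner_Integration.integrable_bound[OF IH(1)[OF Hi]])
      (use P_meas in \<open>auto simp: P_def intro!: AE_I2 order_trans[OF norm_entry_exp_le_tr[OF adjD[OF _ Hi]]]\<close>)
  have Q_int: "integrable M (\<lambda>\<omega>. entry (Q \<omega>) a b)"
    and Q_exp: "expectation (\<lambda>\<omega>. entry (Q \<omega>) a b) = entry (1 + C i) a b" for a b
    using insert.prems by (auto simp: Q_def)
  have indep: "indep_var borel (\<lambda>\<omega>. entry (P \<omega>) a b) borel (\<lambda>\<omega>. entry (Q \<omega>) b a)" for a b
  proof -
    have "indep_var (PiM I (\<lambda>_. borel)) (\<lambda>\<omega>. restrict (\<lambda>j. Z j \<omega>) I)
        (PiM {i} (\<lambda>_. borel)) (\<lambda>\<omega>. restrict (\<lambda>j. Z j \<omega>) {i})"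
      using insert.hyps by (intro indep_var_restrict[OF insert.prems(1)]) auto
    then have "indep_var borel
      ((\<lambda>z. entry (exp (Cmat (mat_of (H - C i) + (\<Sum>j\<in>I. z j - mat_of (C j))))) a b) \<circ> (\<lambda>\<omega>. restrict (\<lambda>j. Z j \<omega>) I))
      borel ((\<lambda>z. entry (exp (Cmat (z i))) b a) \<circ> (\<lambda>\<omega>. restrict (\<lambda>j. Z j \<omega>) {i}))"
      by (rule indep_var_compose) measurable
    then show ?thesis
      by (simp add: comp_def P_def Q_def D_Cmat cong: sum.cong)
  qed
  have PQ_int: "integrable M (\<lambda>\<omega>. entry (P \<omega>) a b * entry (Q \<omega>) b a)"
    and PQ_exp: "expectation (\<lambda>\<omega>. entry (P \<omega>) a b * entry (Q \<omega>) b a)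
      = expectation (\<lambda>\<omega>. entry (P \<omega>) a b * entry (1 + C i) b a)" for a b
    using indep_var_integrable[OF indep P_int Q_int] indep_var_lebesgue_integral[OF indep P_int Q_int]
    by (simp_all add: Q_exp P_int)
  have trPQ_int: "integrable M (\<lambda>\<omega>. tr (P \<omega> * Q \<omega>))"
    unfolding tr_def entry_mult by (intro Bochner_Integration.integrable_sum PQ_int)
  have trPC_int: "integrable M (\<lambda>\<omega>. tr (P \<omega> * (1 + C i)))"
    unfolding tr_def entry_mult by (intro Bochner_Integration.integrable_sum integrable_mult_left P_int)
  have trPQ_exp: "expectation (\<lambda>\<omega>. tr (P \<omega> * Q \<omega>)) = expectation (\<lambda>\<omega>. tr (P \<omega> * (1 + C i)))"
    unfolding tr_def entry_mult
    by (simp only: Bochner_Integration.integral_sum Bochner_Integration.integrable_sum PQ_int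
        integrable_mult_left P_int PQ_exp)
  define F where "F \<omega> = Re (tr (exp (H + (\<Sum>j\<in>insert i I. Cmat (Z j \<omega>) - C j))))" for \<omega>
  have F_eq: "F \<omega> = Re (tr (exp (D (H - C i) \<omega> + Cmat (Z i \<omega>))))" for \<omega>
    using insert.hyps by (simp add: F_def D_def algebra_simps)
  have F_meas: "F \<in> borel_measurable M"
  proof -
    have "F \<omega> = Re (\<Sum>a\<in>UNIV. entry (exp (Cmat (mat_of (H - C i) +
        (\<Sum>j\<in>I. Z j \<omega> - mat_of (C j)) + Z i \<omega>))) a a)" for \<omega>
      by (simp add: F_eq D_Cmat tr_def Cmat_add)
    then show ?thesis unfolding fun_eq_iff[THEN iffD2, rule_format]
      using meas by (subst measurable_cong) (assumption, measurable)
  qed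
  have F_le: "F \<omega> \<le> Re (tr (P \<omega> * Q \<omega>))" if "\<omega> \<in> space M" for \<omega>
    unfolding F_eq P_def Q_def using that insert.prems
    by (intro Golden_Thompson adjD Hi) auto
  have F_nonneg: "0 \<le> F \<omega>" if "\<omega> \<in> space M" for \<omega>
    unfolding F_eq using adjD[OF that Hi] that insert.prems by (intro tr_exp_nonneg) auto
  have F_int: "integrable M F"
    by (rule Bochner_Integration.integrable_bound[OF integrable_Re[OF trPQ_int] F_meas])
      (use F_le F_nonneg in \<open>force intro!: AE_I2\<close>)
  have "expectation F \<le> expectation (\<lambda>\<omega>. Re (tr (P \<omega> * Q \<omega>)))"
    by (intro integral_mono_AE F_int integrable_Re trPQ_int AE_I2 F_le)
  also have "\<dots> = Re (expectation (\<lambda>\<omega>. tr (P \<omega> * (1 + C i))))"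
    by (simp add: trPQ_int trPQ_exp)
  also have "\<dots> = expectation (\<lambda>\<omega>. Re (tr (P \<omega> * (1 + C i))))"
    by (simp add: trPC_int)
  \<comment> \<open>The tangent inequality at \<open>D (H - C i)\<close> puts \<open>C i\<close>
    back into the exponent, which restores the base \<open>H\<close>.\<close>
  also have "\<dots> \<le> expectation (\<lambda>\<omega>. Re (tr (exp (D H \<omega>))))"
  proof (rule integral_mono_AE[OF integrable_Re[OF trPC_int] IH(1)[OF insert.prems(6)]], rule AE_I2)
    fix \<omega> assume "\<omega> \<in> space M"
    then have "Re (tr (P \<omega> * (1 + C i))) \<le> Re (tr (exp (D (H - C i) \<omega> + C i)))"
      unfolding P_def by (intro tr_exp_tangent adjD Hi Ci)
    then show "Re (tr (P \<omega> * (1 + C i))) \<le> Re (tr (exp (D H \<omega>)))"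
      by (simp add: D_def)
  qed
  also have "\<dots> \<le> Re (tr (exp H))" by (intro IH insert.prems)
  finally show ?case using F_int by (simp add: F_def[abs_def])
qed

section \<open>The logarithmic bounding function and tail bounds\<close>

lemma Catoni_pos: "0 < 1 + x + x\<^sup>2 / 2" for x :: real
proof -
  have "1 + x + x\<^sup>2 / 2 = ((1 + x)\<^sup>2 + 1) / 2" by (simp add: power2_eq_square algebra_simps)
  also have "\<dots> > 0" by (simp add: add_nonneg_pos)
  finally show ?thesis .
qed

lemma self_adjoint_scaleR: "self_adjoint A \<Longrightarrow> self_adjoint (c *\<^sub>R A)"
  by (simp add: self_adjoint_iff Cmat_scaleR)

lemma adj_diagonalised: "adj (Cmat (U ** diag_mat l ** mat_adj U)) = Cmat (U ** diag_mat l ** mat_adj U)"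
  by (simp add: Cmat_diagonalised mult.assoc)

lemma adj_mat_fun: "self_adjoint A \<Longrightarrow> adj (Cmat (mat_fun f A)) = Cmat (mat_fun f A)"
  by (metis adj_diagonalised mat_fun_diagonalised)

lemma scaleR_diagonalised:
  "c *\<^sub>R (U ** diag_mat l ** mat_adj U) = U ** diag_mat (\<lambda>i. c * l i) ** mat_adj U"
proof -
  have "Cmat (c *\<^sub>R (U ** diag_mat l ** mat_adj U)) = Cmat (U ** diag_mat (\<lambda>i. c * l i) ** mat_adj U)"
    by (simp add: Cmat_scaleR Cmat_diagonalised flip: dg_scaleR)
  then show ?thesis by (simp add: Cmat_inject)
qed

lemma qf_diagonalised_mono:
  "(\<And>i. l i \<le> m i) \<Longrightarrow> qf x (Cmat (U ** diag_mat l ** mat_adj U)) \<le> qf x (Cmat (U ** diag_mat m ** mat_adj U))"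
  unfolding Cmat_diagonalised qf_mult_dg by (intro sum_mono mult_right_mono) auto

lemma entry_mat_expectation:
  "entry (Cmat (mat_expectation M X)) i j = (\<integral>\<omega>. entry (Cmat (X \<omega>)) i j \<partial>M)"
  by (simp add: mat_expectation_def entry.abs_eq)

lemma adj_mat_expectation:
  assumes "\<And>\<omega>. \<omega> \<in> space M \<Longrightarrow> adj (Cmat (X \<omega>)) = Cmat (X \<omega>)"
  shows "adj (Cmat (mat_expectation M X)) = Cmat (mat_expectation M X)"
proof (rule cmat_eqI)
  fix i j
  have "(\<integral>\<omega>. entry (Cmat (X \<omega>)) i j \<partial>M) = (\<integral>\<omega>. entry (adj (Cmat (X \<omega>))) i j \<partial>M)"
    by (rule Bochner_Integration.integral_cong) (simp_all only: assms)
  then show "entry (adj (Cmat (mat_expectation M X))) i j = entry (Cmat (mat_expectation M X)) i j"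
    by (simp add: entry_mat_expectation)
qed

context
  fixes G :: "complex^'d^'d \<Rightarrow> complex^'d^'d"
  assumes G: "\<And>U l. unitary_mat U \<Longrightarrow>
      G (U ** diag_mat l ** mat_adj U) = U ** diag_mat (\<lambda>i. ln (1 + l i + (l i)\<^sup>2 / 2)) ** mat_adj U"
begin

lemma adj_log_calculus:
  assumes "self_adjoint A"
  shows "adj (Cmat (G A)) = Cmat (G A)"
proof -
  obtain U l where U: "unitary_mat U" "A = U ** diag_mat l ** mat_adj U"
    by (rule self_adjoint_diagonalisable[OF assms])
  show ?thesis unfolding U(2) G[OF U(1)] by (rule adj_diagonalised)
qed

text \<open>\<open>exp\<close> undoes the logarithm eigenvalue by eigenvalue. The result is an exact
  quadratic polynomial in \<open>A\<close>, so its expectation is determined by the first two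
  moments.\<close>

lemma exp_log_calculus:
  assumes "self_adjoint A"
  shows "exp (Cmat (G A)) = 1 + Cmat A + (1/2) *\<^sub>R (Cmat A * Cmat A)"
proof -
  obtain U l where U: "unitary_mat U" and A: "A = U ** diag_mat l ** mat_adj U"
    by (rule self_adjoint_diagonalisable[OF assms])
  let ?V = "Cmat U"
  have V: "unitary ?V" using U by (simp add: unitary_Cmat)
  have "dg (\<lambda>i. 1 + l i + (l i)\<^sup>2 / 2) = 1 + dg l + (1/2) *\<^sub>R (dg l * dg l)"
    by (simp add: dg_mult dg_scaleR dg_add power2_eq_square flip: dg_one)
  moreover have "exp (Cmat (G A)) = ?V * dg (\<lambda>i. 1 + l i + (l i)\<^sup>2 / 2) * adj ?V"
    unfolding A G[OF U] Cmat_diagonalised exp_diagonalised[OF V] using Catoni_pos by simp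
  moreover have "?V * (1 + dg l + (1/2) *\<^sub>R (dg l * dg l)) * adj ?V
      = 1 + Cmat A + (1/2) *\<^sub>R (Cmat A * Cmat A)"
    using V unfolding A Cmat_diagonalised
    by (simp add: distrib_left distrib_right mult.assoc unitary_cancel[OF V]) (simp add: unitary_def)
  ultimately show ?thesis by simp
qed

lemma qf_mat_fun_le:
  assumes "self_adjoint A" and "\<And>x. f x \<le> ln (1 + x + x\<^sup>2 / 2)"
  shows "qf x (Cmat (mat_fun f A)) \<le> qf x (Cmat (G A))"
proof -
  obtain U l where U: "unitary_mat U" "A = U ** diag_mat l ** mat_adj U"
    "mat_fun f A = U ** diag_mat (\<lambda>i. f (l i)) ** mat_adj U"
    by (rule mat_fun_diagonalised[OF assms(1)])
  show ?thesis
    unfolding U(3) by (subst U(2), subst G[OF U(1)]) (intro qf_diagonalised_mono assms(2))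
qed

text \<open>The lower bound on \<open>f\<close> is the upper one reflected through the origin, so
  the same \<open>G\<close> serves, evaluated at \<open>- A\<close>.\<close>

lemma qf_mat_fun_ge:
  assumes "self_adjoint A" and "\<And>x. - ln (1 - x + x\<^sup>2 / 2) \<le> f x"
  shows "- qf x (Cmat (G (- A))) \<le> qf x (Cmat (mat_fun f A))"
proof -
  obtain U l where U: "unitary_mat U" "A = U ** diag_mat l ** mat_adj U"
    "mat_fun f A = U ** diag_mat (\<lambda>i. f (l i)) ** mat_adj U"
    by (rule mat_fun_diagonalised[OF assms(1)])
  have "- A = U ** diag_mat (\<lambda>i. - l i) ** mat_adj U"
    using scaleR_diagonalised[of "-1" U l] by (simp flip: U(2))
  then have "- qf x (Cmat (G (- A)))
      = qf x ((- 1) *\<^sub>R Cmat (U ** diag_mat (\<lambda>i. ln (1 - l i + (l i)\<^sup>2 / 2)) ** mat_adj U))"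
    by (simp add: G[OF U(1)] qf_minus)
  also have "\<dots> \<le> qf x (Cmat (mat_fun f A))"
    unfolding U(3) Cmat_scaleR[symmetric] scaleR_diagonalised
    using assms(2) by (intro qf_diagonalised_mono) simp
  finally show ?thesis .
qed

end

text \<open>Markov's inequality for the trace exponential. The trace dominates the exponential of
  the form at every unit vector, so a single event \<open>B\<close> works for all \<open>x\<close>
  at once. The sign of \<open>\<theta>\<close> is left free: \<open>- \<theta>\<close> yields the
  opposite tail.\<close>

lemma (in prob_space) one_sided_tail:
  fixes Y :: "'i \<Rightarrow> 'a \<Rightarrow> complex^'d^'d" and G :: "complex^'d^'d \<Rightarrow> complex^'d^'d"
  assumes G: "\<And>U l. unitary_mat U \<Longrightarrow>
      G (U ** diag_mat l ** mat_adj U) = U ** diag_mat (\<lambda>i. ln (1 + l i + (l i)\<^sup>2 / 2)) ** mat_adj U"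
    and G_meas: "G \<in> borel_measurable borel"
    and "finite I" and indep: "indep_vars (\<lambda>_. borel) Y I"
    and sa: "\<And>i \<omega>. i \<in> I \<Longrightarrow> \<omega> \<in> space M \<Longrightarrow> self_adjoint (Y i \<omega>)"
    and sq: "\<And>i a b. i \<in> I \<Longrightarrow> integrable M (\<lambda>\<omega>. (norm (Y i \<omega> $ a $ b))\<^sup>2)"
  obtains B where "B \<in> events" "prob B \<le> real CARD('d) * exp (- u)"
    "\<And>\<omega> x. \<omega> \<in> space M - B \<Longrightarrow> norm x = 1 \<Longrightarrow>
      (\<Sum>i\<in>I. qf x (Cmat (G (\<theta> *\<^sub>R Y i \<omega>)))) - \<theta> * qf x (Cmat (\<Sum>i\<in>I. mat_expectation M (Y i)))
      < u + \<theta>\<^sup>2 / 2 * op_norm (\<Sum>i\<in>I. mat_expectation M (\<lambda>\<omega>. Y i \<omega> ** Y i \<omega>))"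
proof -
  define Z where "Z i \<omega> = G (\<theta> *\<^sub>R Y i \<omega>)" for i \<omega>
  define EY where "EY i = Cmat (mat_expectation M (Y i))" for i
  define EYY where "EYY i = Cmat (mat_expectation M (\<lambda>\<omega>. Y i \<omega> ** Y i \<omega>))" for i
  \<comment> \<open>The mean of \<open>exp (Z i)\<close> minus the identity, read off from the
    quadratic polynomial.\<close>
  define C where "C i = \<theta> *\<^sub>R EY i + (\<theta>\<^sup>2 / 2) *\<^sub>R EYY i" for i
  have saC: "adj (Cmat (Y i \<omega>)) = Cmat (Y i \<omega>)" if "i \<in> I" "\<omega> \<in> space M" for i \<omega>
    using sa[OF that] by (simp add: self_adjoint_iff)
  have adjC: "adj (C i) = C i" if "i \<in> I" for i
    using that unfolding C_def EY_def EYY_def by (simp add: adj_mat_expectation saC Cmat_mult)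
  have adjZ: "adj (Cmat (Z i \<omega>)) = Cmat (Z i \<omega>)" if "i \<in> I" "\<omega> \<in> space M" for i \<omega>
    unfolding Z_def using sa[OF that] by (intro adj_log_calculus[OF G] self_adjoint_scaleR)
  have expZ: "exp (Cmat (Z i \<omega>)) = 1 + \<theta> *\<^sub>R Cmat (Y i \<omega>) + (\<theta>\<^sup>2 / 2) *\<^sub>R (Cmat (Y i \<omega>) * Cmat (Y i \<omega>))"
    if "i \<in> I" "\<omega> \<in> space M" for i \<omega>
  proof -
    have "exp (Cmat (Z i \<omega>)) = 1 + Cmat (\<theta> *\<^sub>R Y i \<omega>) + (1/2) *\<^sub>R (Cmat (\<theta> *\<^sub>R Y i \<omega>) * Cmat (\<theta> *\<^sub>R Y i \<omega>))"
      unfolding Z_def by (rule exp_log_calculus[OF G self_adjoint_scaleR[OF sa[OF that]]])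
    then show ?thesis by (simp add: Cmat_scaleR power2_eq_square)
  qed
  have Y_meas: "(\<lambda>\<omega>. Y i \<omega> $ a $ b) \<in> borel_measurable M" if "i \<in> I" for i a b
  proof -
    have "Y i \<in> borel_measurable M" using indep that by (auto simp: indep_vars_def)
    moreover have "(\<lambda>A. A $ a $ b) \<in> borel_measurable (borel :: (complex^'d^'d) measure)"
      by (intro borel_measurable_continuous_onI continuous_intros)
    ultimately show ?thesis by (rule measurable_compose)
  qed
  have Y_int: "integrable M (\<lambda>\<omega>. entry (Cmat (Y i \<omega>)) a b)" if "i \<in> I" for i a b
  proof (rule Bochner_Integration.integrable_bound)
    show "integrable M (\<lambda>\<omega>. 1 + (norm (Y i \<omega> $ a $ b))\<^sup>2)" using sq[OF that] by simp
    have "norm z \<le> 1 + (norm z)\<^sup>2" for z :: complex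
      using sum_squares_bound[of 1 "norm z"] norm_ge_zero[of z] unfolding power_one by linarith
    then show "AE \<omega> in M. norm (entry (Cmat (Y i \<omega>)) a b) \<le> norm (1 + (norm (Y i \<omega> $ a $ b))\<^sup>2)"
      by (auto simp: entry.abs_eq)
  qed (use Y_meas that in \<open>simp add: entry.abs_eq\<close>)
  have prod_int: "integrable M (\<lambda>\<omega>. Y i \<omega> $ a $ c * Y i \<omega> $ c $ b)" if "i \<in> I" for i a b c
  proof (rule Bochner_Integration.integrable_bound)
    show "integrable M (\<lambda>\<omega>. (norm (Y i \<omega> $ a $ c))\<^sup>2 + (norm (Y i \<omega> $ c $ b))\<^sup>2)"
      using sq[OF that] by simp
    have "norm (y * z) \<le> (norm y)\<^sup>2 + (norm z)\<^sup>2" for y z :: complex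
      using sum_squares_bound[of "norm y" "norm z"] mult_nonneg_nonneg[OF norm_ge_zero norm_ge_zero, of y z]
      unfolding norm_mult by linarith
    then show "AE \<omega> in M. norm (Y i \<omega> $ a $ c * Y i \<omega> $ c $ b)
        \<le> norm ((norm (Y i \<omega> $ a $ c))\<^sup>2 + (norm (Y i \<omega> $ c $ b))\<^sup>2)" by simp
  qed (intro borel_measurable_times Y_meas that)
  have YY_int: "integrable M (\<lambda>\<omega>. entry (Cmat (Y i \<omega>) * Cmat (Y i \<omega>)) a b)" if "i \<in> I" for i a b
    unfolding entry_mult using prod_int[OF that] by (simp add: entry.abs_eq)
  have sum_int: "integrable M (\<lambda>\<omega>. entry (1 + \<theta> *\<^sub>R Cmat (Y i \<omega>)
      + (\<theta>\<^sup>2 / 2) *\<^sub>R (Cmat (Y i \<omega>) * Cmat (Y i \<omega>))) a b)" if "i \<in> I" for i a b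
    using Y_int[OF that] YY_int[OF that] by simp
  have mgf_int: "integrable M (\<lambda>\<omega>. entry (exp (Cmat (Z i \<omega>))) a b)" if "i \<in> I" for i a b
    using sum_int[OF that] by (subst Bochner_Integration.integrable_cong[OF refl]) (simp_all add: expZ that)
  have mgf: "expectation (\<lambda>\<omega>. entry (exp (Cmat (Z i \<omega>))) a b) = entry (1 + C i) a b" if "i \<in> I" for i a b
  proof -
    have "expectation (\<lambda>\<omega>. entry (exp (Cmat (Z i \<omega>))) a b)
        = expectation (\<lambda>\<omega>. entry (1 + \<theta> *\<^sub>R Cmat (Y i \<omega>) + (\<theta>\<^sup>2 / 2) *\<^sub>R (Cmat (Y i \<omega>) * Cmat (Y i \<omega>))) a b)"
      by (rule Bochner_Integration.integral_cong) (simp_all add: expZ that)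
    also have "\<dots> = entry (1 + C i) a b"
      using Y_int[OF that] YY_int[OF that]
      by (simp add: C_def EY_def EYY_def entry_mat_expectation Cmat_mult prob_space)
    finally show ?thesis .
  qed
  have Z_indep: "indep_vars (\<lambda>_. borel) Z I"
    unfolding Z_def
    by (rule indep_vars_compose2[OF indep]) (intro measurable_compose[OF _ G_meas] borel_measurable_scaleR borel_measurable_const measurable_ident_sets refl)
  define F where "F \<omega> = Re (tr (exp (\<Sum>i\<in>I. Cmat (Z i \<omega>) - C i)))" for \<omega>
  have F: "integrable M F" "expectation F \<le> real CARD('d)"
    using expectation_tr_exp_sum_le[OF assms(3) Z_indep adjZ adjC mgf_int mgf adj_zero]
    by (auto simp: F_def[abs_def] tr_one)
  have adjS: "adj (\<Sum>i\<in>I. Cmat (Z i \<omega>) - C i) = (\<Sum>i\<in>I. Cmat (Z i \<omega>) - C i)"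
    if "\<omega> \<in> space M" for \<omega>
    using that adjZ adjC by simp
  have F_nonneg: "0 \<le> F \<omega>" if "\<omega> \<in> space M" for \<omega>
    unfolding F_def by (intro tr_exp_nonneg adjS that)
  define B where "B = {\<omega> \<in> space M. F \<omega> \<ge> exp u}"
  show thesis
  proof (rule that[of B])
    show "B \<in> events"
      unfolding B_def using borel_measurable_integrable[OF F(1)] by measurable
    have "prob B \<le> expectation F / exp u"
      unfolding B_def using F(1) F_nonneg
      by (intro integral_Markov_inequality_measure[where A="space M"]) auto
    also have "\<dots> \<le> real CARD('d) / exp u" using F(2) by (intro divide_right_mono) auto
    finally show "prob B \<le> real CARD('d) * exp (- u)" by (simp add: exp_minus divide_inverse)
  next
    fix \<omega> and x :: "complex^'d"
    assume \<omega>: "\<omega> \<in> space M - B" and x: "norm x = 1"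
    let ?S = "\<Sum>i\<in>I. Cmat (Z i \<omega>) - C i"
    have "exp (qf x ?S) \<le> F \<omega>"
      unfolding F_def using \<omega> x adjS by (intro exp_le_tr_exp) auto
    also have "\<dots> < exp u" using \<omega> by (auto simp: B_def)
    finally have "qf x ?S < u" by simp
    moreover have "qf x ?S = (\<Sum>i\<in>I. qf x (Cmat (Z i \<omega>))) - \<theta> * qf x (\<Sum>i\<in>I. EY i)
        - \<theta>\<^sup>2 / 2 * qf x (\<Sum>i\<in>I. EYY i)"
      by (simp add: qf_sum qf_diff qf_add qf_scaleR C_def sum_subtractf sum.distrib sum_distrib_left)
    \<comment> \<open>Here the variance proxy arises: the second moments are summed as matrices
      before the norm is taken.\<close>
    moreover have "\<theta>\<^sup>2 / 2 * qf x (\<Sum>i\<in>I. EYY i)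
        \<le> \<theta>\<^sup>2 / 2 * op_norm (\<Sum>i\<in>I. mat_expectation M (\<lambda>\<omega>. Y i \<omega> ** Y i \<omega>))"
      unfolding EYY_def Cmat_sum[symmetric] norm_Cmat[symmetric]
      using qf_le_norm[OF x] by (intro mult_left_mono) auto
    ultimately show "(\<Sum>i\<in>I. qf x (Cmat (G (\<theta> *\<^sub>R Y i \<omega>)))) - \<theta> * qf x (Cmat (\<Sum>i\<in>I. mat_expectation M (Y i)))
        < u + \<theta>\<^sup>2 / 2 * op_norm (\<Sum>i\<in>I. mat_expectation M (\<lambda>\<omega>. Y i \<omega> ** Y i \<omega>))"
      by (simp add: Z_def EY_def Cmat_sum)
  qed
qed

text \<open>Two one-sided tails, at \<open>\<theta>\<close> and \<open>- \<theta>\<close>, sandwich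
  the form of the estimator and give the factor 2. The exceptional set is an event built from
  \<open>G\<close>, so measurability questions about \<open>\<psi>\<close> do not enter.\<close>

theorem (in prob_space) op_norm_deviation:
  fixes Y :: "'i \<Rightarrow> 'a \<Rightarrow> complex^'d^'d"
  assumes I: "finite I" "I \<noteq> {}" and indep: "indep_vars (\<lambda>_. borel) Y I"
    and sa: "\<And>i \<omega>. i \<in> I \<Longrightarrow> \<omega> \<in> space M \<Longrightarrow> self_adjoint (Y i \<omega>)"
    and sq: "\<And>i a b. i \<in> I \<Longrightarrow> integrable M (\<lambda>\<omega>. (norm (Y i \<omega> $ a $ b))\<^sup>2)"
    and lower: "\<And>x. - ln (1 - x + x\<^sup>2 / 2) \<le> \<psi> x"
    and upper: "\<And>x. \<psi> x \<le> ln (1 + x + x\<^sup>2 / 2)"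
    and "\<theta> > 0"
  obtains B where "B \<in> events"
    "prob B \<le> 2 * real CARD('d) * exp (\<theta>\<^sup>2 / 2 *
      op_norm (\<Sum>i\<in>I. mat_expectation M (\<lambda>\<omega>. Y i \<omega> ** Y i \<omega>)) - real (card I) * \<theta> * \<tau>)"
    "\<And>\<omega>. \<omega> \<in> space M - B \<Longrightarrow>
      op_norm ((1 / (real (card I) * \<theta>)) *\<^sub>R (\<Sum>i\<in>I. mat_fun \<psi> (\<theta> *\<^sub>R Y i \<omega>))
        - (1 / real (card I)) *\<^sub>R (\<Sum>i\<in>I. mat_expectation M (Y i))) < \<tau>"
proof -
  define v where "v = op_norm (\<Sum>i\<in>I. mat_expectation M (\<lambda>\<omega>. Y i \<omega> ** Y i \<omega>))"
  define E where "E = (\<Sum>i\<in>I. mat_expectation M (Y i))"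
  define n where "n = real (card I)"
  \<comment> \<open>Chosen so that \<open>u + \<theta>^2 / 2 * v = n * \<theta> * \<tau>\<close>,
    the right-hand side of the one-sided bounds.\<close>
  define u where "u = n * \<theta> * \<tau> - \<theta>\<^sup>2 / 2 * v"
  have n: "n > 0" using I by (simp add: n_def card_gt_0_iff)
  have "continuous_on UNIV (\<lambda>x::real. ln (1 + x + x\<^sup>2 / 2))"
    by (intro continuous_intros) (simp_all add: less_imp_neq[OF Catoni_pos, symmetric])
  then obtain G :: "complex^'d^'d \<Rightarrow> complex^'d^'d" where G_meas: "G \<in> borel_measurable borel"
    and G: "\<And>U l. unitary_mat U \<Longrightarrow> G (U ** diag_mat l ** mat_adj U)
      = U ** diag_mat (\<lambda>i. ln (1 + l i + (l i)\<^sup>2 / 2)) ** mat_adj U"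
    by (rule measurable_spectral_calculus) blast
  obtain B1 where B1: "B1 \<in> events" "prob B1 \<le> real CARD('d) * exp (- u)"
    "\<And>\<omega> x. \<omega> \<in> space M - B1 \<Longrightarrow> norm x = 1 \<Longrightarrow>
      (\<Sum>i\<in>I. qf x (Cmat (G (\<theta> *\<^sub>R Y i \<omega>)))) - \<theta> * qf x (Cmat E) < u + \<theta>\<^sup>2 / 2 * v"
    unfolding v_def E_def using one_sided_tail[OF G G_meas I(1) indep sa sq, of u \<theta>] by blast
  obtain B2 where B2: "B2 \<in> events" "prob B2 \<le> real CARD('d) * exp (- u)"
    "\<And>\<omega> x. \<omega> \<in> space M - B2 \<Longrightarrow> norm x = 1 \<Longrightarrow>
      (\<Sum>i\<in>I. qf x (Cmat (G (- \<theta> *\<^sub>R Y i \<omega>)))) - (- \<theta>) * qf x (Cmat E) < u + (- \<theta>)\<^sup>2 / 2 * v"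
    unfolding v_def E_def using one_sided_tail[OF G G_meas I(1) indep sa sq, of u "- \<theta>"] by blast
  show thesis
  proof (rule that[of "B1 \<union> B2"])
    show "B1 \<union> B2 \<in> events" using B1 B2 by auto
    have "prob (B1 \<union> B2) \<le> prob B1 + prob B2" by (rule measure_Un_le[OF B1(1) B2(1)])
    also have "\<dots> \<le> 2 * real CARD('d) * exp (\<theta>\<^sup>2 / 2 * v - n * \<theta> * \<tau>)"
      using B1(2) B2(2) by (simp add: u_def)
    finally show "prob (B1 \<union> B2) \<le> 2 * real CARD('d) * exp (\<theta>\<^sup>2 / 2 *
      op_norm (\<Sum>i\<in>I. mat_expectation M (\<lambda>\<omega>. Y i \<omega> ** Y i \<omega>)) - real (card I) * \<theta> * \<tau>)"
      by (simp add: v_def n_def)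
  next
    fix \<omega> assume \<omega>: "\<omega> \<in> space M - (B1 \<union> B2)"
    define P where "P i = Cmat (mat_fun \<psi> (\<theta> *\<^sub>R Y i \<omega>))" for i
    define A where "A = (1 / (n * \<theta>)) *\<^sub>R (\<Sum>i\<in>I. P i) - (1 / n) *\<^sub>R Cmat E"
    have sa\<omega>: "self_adjoint (\<theta> *\<^sub>R Y i \<omega>)" if "i \<in> I" for i
      using sa that \<omega> by (auto intro: self_adjoint_scaleR)
    have "adj (Cmat E) = Cmat E"
      unfolding E_def using sa by (simp add: Cmat_sum adj_mat_expectation flip: self_adjoint_iff)
    then have "adj A = A"
      using sa\<omega> by (simp add: A_def P_def adj_mat_fun)
    then obtain x where x: "norm x = 1" "norm A \<le> \<bar>qf x A\<bar>"
      by (rule adj_eq_norm_attained)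
    have qA: "n * \<theta> * qf x A = (\<Sum>i\<in>I. qf x (P i)) - \<theta> * qf x (Cmat E)"
      using n \<open>\<theta> > 0\<close> by (simp add: A_def qf_diff qf_scaleR qf_sum field_simps)
    have "(\<Sum>i\<in>I. qf x (P i)) \<le> (\<Sum>i\<in>I. qf x (Cmat (G (\<theta> *\<^sub>R Y i \<omega>))))"
      unfolding P_def by (intro sum_mono qf_mat_fun_le[OF G] sa\<omega> upper)
    then have up: "n * \<theta> * qf x A < n * \<theta> * \<tau>"
      using B1(3)[of \<omega> x] \<omega> x unfolding qA u_def by simp
    have "(\<Sum>i\<in>I. - qf x (Cmat (G (- (\<theta> *\<^sub>R Y i \<omega>))))) \<le> (\<Sum>i\<in>I. qf x (P i))"
      unfolding P_def by (intro sum_mono qf_mat_fun_ge[OF G] sa\<omega> lower)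
    then have "- (n * \<theta> * qf x A) < n * \<theta> * \<tau>"
      using B2(3)[of \<omega> x] \<omega> x unfolding qA u_def by (simp add: sum_negf)
    then have low: "n * \<theta> * (- qf x A) < n * \<theta> * \<tau>" by simp
    have "n * \<theta> > 0" using n \<open>\<theta> > 0\<close> by simp
    then have "\<bar>qf x A\<bar> < \<tau>"
      using up low by (simp only: mult_less_cancel_left_pos)
    then have "norm A < \<tau>" using x by simp
    moreover have "A = Cmat ((1 / (n * \<theta>)) *\<^sub>R (\<Sum>i\<in>I. mat_fun \<psi> (\<theta> *\<^sub>R Y i \<omega>)) - (1 / n) *\<^sub>R E)"
      by (simp only: A_def P_def Cmat_diff Cmat_scaleR Cmat_sum)
    ultimately show "op_norm ((1 / (real (card I) * \<theta>)) *\<^sub>R (\<Sum>i\<in>I. mat_fun \<psi> (\<theta> *\<^sub>R Y i \<omega>))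
        - (1 / real (card I)) *\<^sub>R (\<Sum>i\<in>I. mat_expectation M (Y i))) < \<tau>"
      by (simp add: norm_Cmat n_def E_def)
  qed
qed

section \<open>Lepski's selection rule\<close>

lemma op_norm_diff_triangle: "op_norm (A - C) \<le> op_norm (A - B) + op_norm (B - C)"
  for A B C :: "complex^'d^'d"
  using op_norm_triangle[of "A - B" "B - C"] by simp

lemma op_norm_minus_commute: "op_norm (A - B) = op_norm (B - A)" for A B :: "complex^'d^'d"
  using op_norm_scaleR[of "-1" "A - B"] by simp

text \<open>The accuracies at \<open>j\<close> and at a coarser \<open>k\<close> add up to at most
  \<open>2 * \<sigma> k * s\<close>, so \<open>j\<close> passes the selection test and the selected
  index is at most \<open>j\<close>. Testing the selected index against \<open>j\<close> costs
  \<open>2 * \<sigma> j * s\<close>, to which the accuracy at \<open>j\<close> is added. The weights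
  \<open>c\<close> may vary so that a single scale can get a wider threshold.\<close>

lemma Lepski_selection:
  fixes T :: "int \<Rightarrow> complex^'d^'d"
  assumes J: "finite J" "j \<in> J"
    and dev: "\<And>k. k \<in> J \<Longrightarrow> j \<le> k \<Longrightarrow> op_norm (T k - A) < c k * \<sigma> k * s"
    and c: "\<And>k. k \<in> J \<Longrightarrow> j < k \<Longrightarrow> c j * \<sigma> j + c k * \<sigma> k \<le> 2 * \<sigma> k"
    and "0 \<le> \<sigma> j" "0 \<le> s"
  shows "op_norm (T (Min {j \<in> J. \<forall>k\<in>J. k > j \<longrightarrow> op_norm (T k - T j) \<le> 2 * \<sigma> k * s}) - A)
    < (2 + c j) * \<sigma> j * s"
proof -
  define K where "K = {j \<in> J. \<forall>k\<in>J. k > j \<longrightarrow> op_norm (T k - T j) \<le> 2 * \<sigma> k * s}"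
  have "j \<in> K"
    unfolding K_def
  proof (intro CollectI conjI ballI impI J)
    fix k assume k: "k \<in> J" "j < k"
    have "op_norm (T k - T j) \<le> op_norm (T k - A) + op_norm (A - T j)"
      by (rule op_norm_diff_triangle)
    also have "\<dots> \<le> c k * \<sigma> k * s + c j * \<sigma> j * s"
      using dev[OF k(1)] dev[OF J(2)] k by (simp add: op_norm_minus_commute[of A])
    also have "\<dots> = (c j * \<sigma> j + c k * \<sigma> k) * s" by (simp add: algebra_simps)
    also have "\<dots> \<le> 2 * \<sigma> k * s" using c[OF k] \<open>0 \<le> s\<close> by (intro mult_right_mono) auto
    finally show "op_norm (T k - T j) \<le> 2 * \<sigma> k * s" .
  qed
  moreover have "finite K" unfolding K_def using J by simp
  ultimately have K: "Min K \<in> K" "Min K \<le> j" by (auto intro: Min_in)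
  have "op_norm (T j - T (Min K)) \<le> 2 * \<sigma> j * s"
  \<comment> \<open>The test compares only with strictly larger indices, so equality has to be
    treated separately.\<close>
  proof (cases "Min K = j")
    case True
    then show ?thesis using assms(5,6) op_norm_eq_0[of "0 :: complex^'d^'d"] by simp
  next
    case False
    then show ?thesis using K J(2) by (auto simp: K_def)
  qed
  then have "op_norm (T (Min K) - T j) \<le> 2 * \<sigma> j * s" by (simp add: op_norm_minus_commute)
  moreover have "op_norm (T j - A) < c j * \<sigma> j * s" using dev J by blast
  ultimately have "op_norm (T (Min K) - A) < 2 * \<sigma> j * s + c j * \<sigma> j * s"
    using op_norm_diff_triangle[of "T (Min K)" A "T j"] by linarith
  then show ?thesis by (simp add: K_def algebra_simps)
qed

text \<open>In logarithmic coordinates the grid is \<open>{0..<\<lceil>L\<rceil>}\<close> with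
  \<open>L = log 2 (2 * b / a)\<close>. Its cardinality can exceed \<open>L\<close>, but without the
  index 0 it is \<open>\<lceil>L\<rceil> - 1\<close>, hence at most \<open>L\<close>.\<close>

lemma dyadic_grid:
  fixes a b :: real
  assumes "0 < a" "a \<le> b"
  defines "J \<equiv> {j::int. a \<le> 2 powi j * a \<and> 2 powi j * a < 2 * b}"
  shows "finite J" "0 \<in> J" "real (card (J - {0})) \<le> log 2 (2 * b / a)"
    "\<And>j. j \<in> J \<Longrightarrow> 0 \<le> j" "\<exists>j\<in>J. b \<le> 2 powi j * a" "\<And>j. j \<in> J \<Longrightarrow> 0 < j \<Longrightarrow> j - 1 \<in> J"
proof -
  define L where "L = log 2 (2 * b / a)"
  have nonneg_iff: "a \<le> 2 powi j * a \<longleftrightarrow> 0 \<le> j" for j :: int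
  proof -
    have "a \<le> 2 powi j * a \<longleftrightarrow> (2::real) powr 0 \<le> 2 powr real_of_int j"
      using assms by (simp add: powr_real_of_int')
    also have "\<dots> \<longleftrightarrow> 0 \<le> j" by (subst powr_le_cancel_iff) auto
    finally show ?thesis .
  qed
  have less_iff: "2 powi j * a < 2 * b \<longleftrightarrow> real_of_int j < L" for j :: int
  proof -
    have "2 powi j * a < 2 * b \<longleftrightarrow> (2::real) powr real_of_int j < 2 * b / a"
      using assms by (simp add: field_simps powr_real_of_int')
    also have "\<dots> \<longleftrightarrow> real_of_int j < L"
      unfolding L_def using assms by (subst less_log_iff) auto
    finally show ?thesis .
  qed
  have J: "J = {0..<\<lceil>L\<rceil>}"
    unfolding J_def nonneg_iff less_iff by (auto simp: less_ceiling_iff)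
  have L: "L \<ge> 1"
    unfolding L_def using assms by (simp add: le_log_iff field_simps)
  show "finite J" "\<And>j. j \<in> J \<Longrightarrow> 0 \<le> j" "\<And>j. j \<in> J \<Longrightarrow> 0 < j \<Longrightarrow> j - 1 \<in> J"
    by (auto simp: J)
  show "0 \<in> J" using L by (simp add: J)
  have "J - {0} = {1..<\<lceil>L\<rceil>}" by (auto simp: J)
  then have "real (card (J - {0})) = of_int \<lceil>L\<rceil> - 1" using L by simp
  also have "\<dots> \<le> L" by linarith
  finally show "real (card (J - {0})) \<le> log 2 (2 * b / a)" by (simp add: L_def)
  show "\<exists>j\<in>J. b \<le> 2 powi j * a"
  proof (rule bexI)
    show "\<lceil>L\<rceil> - 1 \<in> J" using L by (simp add: J)
    \<comment> \<open>The first scale beyond the grid is at least \<open>2 * b\<close>; halving it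
      gives the last scale in the grid.\<close>
    have "\<not> 2 powi \<lceil>L\<rceil> * a < 2 * b" unfolding less_iff by linarith
    then show "b \<le> 2 powi (\<lceil>L\<rceil> - 1) * a" by (simp add: power_int_diff)
  qed
qed

section \<open>Union bound over the scales\<close>

text \<open>The numerical core of the boundary case. In terms of \<open>q = exp (- t / 4)\<close>
  the claim reads \<open>q^12 + m * q^7 \<le> L * q^4\<close>; after division by \<open>q^4\<close>
  it follows from \<open>q^8 \<le> 1/4\<close>, \<open>q^3 \<le> 3/4\<close> and
  \<open>1 \<le> L\<close>.\<close>

lemma exp_sum_bound:
  fixes t L m :: real
  assumes "ln 2 \<le> t" "m \<le> L" "1 \<le> L"
  shows "exp (t - 4 * t) + m * exp (t / 4 - 2 * t) \<le> L * exp (- t)"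
proof -
  define q where "q = exp (- t / 4)"
  have q: "q > 0" by (simp add: q_def)
  have pow: "exp (- t * real k / 4) = q ^ k" for k
    by (simp add: q_def flip: exp_of_nat_mult)
  have "q ^ 4 = exp (- t)" using pow[of 4] by simp
  also have "\<dots> \<le> exp (- ln 2)" using assms by simp
  finally have q4: "q ^ 4 \<le> 1/2" by (simp add: exp_minus)
  have "(q ^ 4) ^ 2 \<le> (1/2) ^ 2" using q4 q by (intro power_mono) auto
  then have q8: "q ^ 8 \<le> 1/4" by (simp add: power2_eq_square flip: power_add)
  \<comment> \<open>Compare twelfth powers: \<open>q^12 \<le> 1/8\<close>, whereas
    \<open>(3/4)^4\<close> is 81/256.\<close>
  have q3: "q ^ 3 \<le> 3/4"
  proof (rule ccontr)
    assume "\<not> q ^ 3 \<le> 3/4"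
    then have "(3/4) ^ 4 < (q ^ 3) ^ 4" by (intro power_strict_mono) auto
    moreover have "(q ^ 3) ^ 4 = (q ^ 4) ^ 3" by (simp flip: power_mult)
    moreover have "(q ^ 4) ^ 3 \<le> (1/2) ^ 3" using q4 q by (intro power_mono) auto
    ultimately show False by (simp add: power_divide)
  qed
  have "exp (t - 4 * t) + m * exp (t / 4 - 2 * t) = q ^ 12 + m * q ^ 7"
    using pow[of 12] pow[of 7] by (simp add: algebra_simps)
  also have "\<dots> \<le> q ^ 12 + L * q ^ 7" using assms q by (intro add_left_mono mult_right_mono) auto
  also have "\<dots> = q ^ 4 * (q ^ 8 + L * q ^ 3)"
    by (simp add: algebra_simps flip: power_add)
  also have "\<dots> \<le> q ^ 4 * (1/4 + L * (3/4))"
    using q8 q3 q assms by (intro mult_left_mono add_mono) auto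
  also have "\<dots> \<le> q ^ 4 * L" using q assms by (intro mult_left_mono) auto
  also have "\<dots> = L * exp (- t)" using pow[of 4] by simp
  finally show ?thesis .
qed

theorem theorem5p1:
  fixes M :: "'a measure"
    and Y :: "nat \<Rightarrow> 'a \<Rightarrow> complex^'d^'d"
    and \<psi> :: "real \<Rightarrow> real"
    and n :: nat
    and \<sigma>min \<sigma>max t :: real
  assumes "prob_space M"
    and "mono \<psi>"
    and "\<And>x. - ln (1 - x + x\<^sup>2 / 2) \<le> \<psi> x"
    and "\<And>x. \<psi> x \<le> ln (1 + x + x\<^sup>2 / 2)"
    and "n \<ge> 1"
    and "\<And>i. i \<in> {1..n} \<Longrightarrow> Y i \<in> borel_measurable M"
    and "prob_space.indep_vars M (\<lambda>_. borel) Y {1..n}"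
    and "\<And>i \<omega>. i \<in> {1..n} \<Longrightarrow> \<omega> \<in> space M \<Longrightarrow> self_adjoint (Y i \<omega>)"
    and "\<And>i a b. i \<in> {1..n} \<Longrightarrow> integrable M (\<lambda>\<omega>. (norm (Y i \<omega> $ a $ b))\<^sup>2)"
    and "0 < \<sigma>min"
    and "\<sigma>min \<le> sqrt (op_norm (\<Sum>i=1..n. mat_expectation M (\<lambda>\<omega>. Y i \<omega> ** Y i \<omega>))) / sqrt (real n)"
    and "sqrt (op_norm (\<Sum>i=1..n. mat_expectation M (\<lambda>\<omega>. Y i \<omega> ** Y i \<omega>))) / sqrt (real n) \<le> \<sigma>max"
    and "t > 0"
  shows
    "let \<sigma>n = sqrt (op_norm (\<Sum>i=1..n. mat_expectation M (\<lambda>\<omega>. Y i \<omega> ** Y i \<omega>)));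
         EYbar = (1 / real n) *\<^sub>R (\<Sum>i=1..n. mat_expectation M (Y i));
         \<sigma> = (\<lambda>j::int. 2 powi j * \<sigma>min);
         J = {j::int. \<sigma>min \<le> \<sigma> j \<and> \<sigma> j < 2 * \<sigma>max};
         \<theta> = (\<lambda>j. sqrt (2 * t / real n) / \<sigma> j);
         T = (\<lambda>j \<omega>. (1 / (real n * \<theta> j)) *\<^sub>R (\<Sum>i=1..n. mat_fun \<psi> (\<theta> j *\<^sub>R Y i \<omega>)));
         jstar = (\<lambda>\<omega>. Min {j \<in> J. \<forall>k \<in> J. k > j \<longrightarrow>
                        op_norm (T k \<omega> - T j \<omega>) \<le> 2 * \<sigma> k * sqrt (2 * t / real n)});
         Tstar = (\<lambda>\<omega>. T (jstar \<omega>) \<omega>)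
     in measure M {\<omega> \<in> space M. op_norm (Tstar \<omega> - EYbar) \<ge> 6 * (\<sigma>n / sqrt (real n)) * sqrt (2 * t / real n)}
        \<le> 2 * real CARD('d) * log 2 (2 * \<sigma>max / \<sigma>min) * exp (- t)"
proof -
  interpret prob_space M by fact
  define S where "S = op_norm (\<Sum>i=1..n. mat_expectation M (\<lambda>\<omega>. Y i \<omega> ** Y i \<omega>))"
  define v where "v = sqrt S / sqrt (real n)"
  define s where "s = sqrt (2 * t / real n)"
  define EYbar where "EYbar = (1 / real n) *\<^sub>R (\<Sum>i=1..n. mat_expectation M (Y i))"
  define \<sigma> where "\<sigma> = (\<lambda>j::int. 2 powi j * \<sigma>min)"
  define J where "J = {j::int. \<sigma>min \<le> \<sigma> j \<and> \<sigma> j < 2 * \<sigma>max}"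
  define \<theta> where "\<theta> = (\<lambda>j. s / \<sigma> j)"
  define T where "T = (\<lambda>j \<omega>. (1 / (real n * \<theta> j)) *\<^sub>R (\<Sum>i=1..n. mat_fun \<psi> (\<theta> j *\<^sub>R Y i \<omega>)))"
  define bad where "bad = {\<omega> \<in> space M. 6 * v * s \<le>
    op_norm (T (Min {j \<in> J. \<forall>k \<in> J. k > j \<longrightarrow> op_norm (T k \<omega> - T j \<omega>) \<le> 2 * \<sigma> k * s}) \<omega> - EYbar)}"
  define D where "D = 2 * real CARD('d)"
  define L where "L = log 2 (2 * \<sigma>max / \<sigma>min)"
  have n: "real n > 0" using assms(5) by simp
  have v: "\<sigma>min \<le> v" "v \<le> \<sigma>max" using assms(11,12) by (simp_all add: v_def S_def)
  have "0 \<le> S" unfolding S_def by (rule op_norm_nonneg)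
  then have S: "S = real n * v\<^sup>2" using n by (simp add: v_def power_divide)
  have s: "s > 0" "real n * s\<^sup>2 = 2 * t" using n \<open>t > 0\<close> by (simp_all add: s_def)
  have \<sigma>_pos: "\<sigma> k > 0" for k using \<open>0 < \<sigma>min\<close> by (simp add: \<sigma>_def)
  have \<sigma>_double: "2 * \<sigma> j \<le> \<sigma> k" if "j < k" for j k
  proof -
    have "(2::real) powi (j + 1) \<le> 2 powi k" using that by (intro power_int_increasing) auto
    then show ?thesis using \<open>0 < \<sigma>min\<close> by (simp add: \<sigma>_def power_int_add)
  qed
  have \<sigma>0: "\<sigma> 0 = \<sigma>min" by (simp add: \<sigma>_def)
  have D: "D \<ge> 2" by (simp add: D_def Suc_leI)
  have "\<sigma>min \<le> \<sigma>max" using v by simp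
  have J: "finite J" "0 \<in> J" "real (card (J - {0})) \<le> L" "\<And>j. j \<in> J \<Longrightarrow> 0 \<le> j"
    "\<exists>j\<in>J. \<sigma>max \<le> \<sigma> j" "\<And>j. j \<in> J \<Longrightarrow> 0 < j \<Longrightarrow> j - 1 \<in> J"
    using dyadic_grid[OF \<open>0 < \<sigma>min\<close> \<open>\<sigma>min \<le> \<sigma>max\<close>] unfolding J_def \<sigma>_def L_def by blast+
  have L: "L \<ge> 1"
    unfolding L_def using \<open>0 < \<sigma>min\<close> \<open>\<sigma>min \<le> \<sigma>max\<close> by (simp add: le_log_iff field_simps)
  \<comment> \<open>Since \<open>real n * s^2 = 2 * t\<close>, the variance term of the exponent
    becomes \<open>t * (v / \<sigma> k)^2\<close> and the threshold term \<open>2 * t * c\<close>.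
    The threshold is kept as a parameter because the boundary case needs two values of it.\<close>
  have "\<exists>B. B \<in> events \<and> prob B \<le> D * exp (t * (v / \<sigma> k)\<^sup>2 - 2 * t * c) \<and>
      (\<forall>\<omega>\<in>space M - B. op_norm (T k \<omega> - EYbar) < c * \<sigma> k * s)" for k c
  proof -
    have \<theta>: "\<theta> k > 0" using s \<sigma>_pos by (simp add: \<theta>_def)
    have e1: "(\<theta> k)\<^sup>2 / 2 * S = t * (v / \<sigma> k)\<^sup>2"
    proof -
      have "(\<theta> k)\<^sup>2 / 2 * S = (real n * s\<^sup>2) / 2 * (v / \<sigma> k)\<^sup>2"
        by (simp add: \<theta>_def S power_divide mult_ac)
      then show ?thesis by (simp add: s(2))
    qed
    have e2: "real n * \<theta> k * (c * \<sigma> k * s) = 2 * t * c"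
      using s(2) \<sigma>_pos[of k] by (simp add: \<theta>_def power2_eq_square)
    have "{1..n} \<noteq> {}" using assms(5) by simp
    from op_norm_deviation[OF finite_atLeastAtMost this assms(7-9) assms(3,4) \<theta>, of "c * \<sigma> k * s"]
    obtain B where "B \<in> events"
      "prob B \<le> D * exp ((\<theta> k)\<^sup>2 / 2 * S - real n * \<theta> k * (c * \<sigma> k * s))"
      "\<And>\<omega>. \<omega> \<in> space M - B \<Longrightarrow> op_norm (T k \<omega> - EYbar) < c * \<sigma> k * s"
      unfolding T_def EYbar_def D_def S_def card_atLeastAtMost diff_Suc_1 by blast
    then show ?thesis unfolding e1 e2 by blast
  qed
  then obtain B where B: "\<And>k c. B k c \<in> events"
    "\<And>k c. prob (B k c) \<le> D * exp (t * (v / \<sigma> k)\<^sup>2 - 2 * t * c)"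
    "\<And>k c \<omega>. \<omega> \<in> space M - B k c \<Longrightarrow> op_norm (T k \<omega> - EYbar) < c * \<sigma> k * s"
    by metis
  \<comment> \<open>Common to both cases below; only the reference index \<open>j\<close> and the
    weights \<open>c\<close> differ. The last condition is the budget of 6 for the loss in the
    selection.\<close>
  have bad_le: "prob bad \<le> (\<Sum>k\<in>{k\<in>J. j \<le> k}. D * exp (t * (v / \<sigma> k)\<^sup>2 - 2 * t * c k))"
    if "j \<in> J" "\<And>k. k \<in> J \<Longrightarrow> j < k \<Longrightarrow> c j * \<sigma> j + c k * \<sigma> k \<le> 2 * \<sigma> k"
      "(2 + c j) * \<sigma> j \<le> 6 * v" for j c
  proof -
    have "bad \<subseteq> (\<Union>k\<in>{k\<in>J. j \<le> k}. B k (c k))"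
    proof
      fix \<omega> assume \<omega>: "\<omega> \<in> bad"
      show "\<omega> \<in> (\<Union>k\<in>{k\<in>J. j \<le> k}. B k (c k))"
      proof (rule ccontr)
        assume "\<omega> \<notin> (\<Union>k\<in>{k\<in>J. j \<le> k}. B k (c k))"
        then have "op_norm (T k \<omega> - EYbar) < c k * \<sigma> k * s" if "k \<in> J" "j \<le> k" for k
          using B(3) \<omega> that by (auto simp: bad_def)
        then have "op_norm (T (Min {j \<in> J. \<forall>k \<in> J. k > j \<longrightarrow>
            op_norm (T k \<omega> - T j \<omega>) \<le> 2 * \<sigma> k * s}) \<omega> - EYbar) < (2 + c j) * \<sigma> j * s"
          using J(1) that s(1) \<sigma>_pos by (intro Lepski_selection[where T="\<lambda>k. T k \<omega>"]) (auto intro: less_imp_le)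
        also have "\<dots> \<le> 6 * v * s" using that(3) s by (intro mult_right_mono) auto
        finally show False using \<omega> by (simp add: bad_def)
      qed
    qed
    \<comment> \<open>Monotonicity asks only the covering union to be an event, not
      \<open>bad\<close> itself.\<close>
    then have "prob bad \<le> prob (\<Union>k\<in>{k\<in>J. j \<le> k}. B k (c k))"
      using B(1) J(1) by (intro finite_measure_mono) auto
    also have "\<dots> \<le> (\<Sum>k\<in>{k\<in>J. j \<le> k}. prob (B k (c k)))"
      using B(1) J(1) by (intro finite_measure_subadditive_finite) auto
    also have "\<dots> \<le> (\<Sum>k\<in>{k\<in>J. j \<le> k}. D * exp (t * (v / \<sigma> k)\<^sup>2 - 2 * t * c k))"
      by (intro sum_mono B(2))
    finally show ?thesis .
  qed
  have "prob bad \<le> D * L * exp (- t)"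
  proof (cases "v = \<sigma>min")
    case False
    \<comment> \<open>The smallest scale that reaches \<open>v\<close>. As \<open>v\<close> exceeds
      \<open>\<sigma> 0\<close>, this index is positive, so its predecessor lies in the grid below
      \<open>v\<close>; hence \<open>\<sigma> j \<le> 2 * v\<close>, and weight 1 uses up exactly 3
      * 2 = 6.\<close>
    define j where "j = Min {j \<in> J. v \<le> \<sigma> j}"
    have "{j \<in> J. v \<le> \<sigma> j} \<noteq> {}" using J(5) v by force
    then have j: "j \<in> J" "v \<le> \<sigma> j" using Min_in[of "{j \<in> J. v \<le> \<sigma> j}"] J(1) by (auto simp: j_def)
    have "j \<noteq> 0" using j(2) False v \<sigma>0 by auto
    then have "0 < j" using J(4)[OF j(1)] by simp
    have "\<not> v \<le> \<sigma> (j - 1)"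
    proof
      assume "v \<le> \<sigma> (j - 1)"
      then have "j \<le> j - 1"
        using J(1) J(6)[OF j(1) \<open>0 < j\<close>] unfolding j_def by (intro Min_le) (auto simp flip: j_def)
      then show False by simp
    qed
    moreover have "\<sigma> j = 2 * \<sigma> (j - 1)" by (simp add: \<sigma>_def power_int_diff)
    ultimately have j2: "\<sigma> j \<le> 2 * v" by simp
    have "prob bad \<le> (\<Sum>k\<in>{k\<in>J. j \<le> k}. D * exp (t * (v / \<sigma> k)\<^sup>2 - 2 * t * 1))"
    proof (rule bad_le[OF j(1)])
      show "1 * \<sigma> j + 1 * \<sigma> k \<le> 2 * \<sigma> k" if "j < k" for k
        using \<sigma>_double[OF that] \<sigma>_pos[of j] by linarith
    qed (use j2 in simp)
    also have "\<dots> \<le> (\<Sum>k\<in>{k\<in>J. j \<le> k}. D * exp (- t))"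
    proof (intro sum_mono mult_left_mono)
      fix k assume "k \<in> {k\<in>J. j \<le> k}"
      then have "v \<le> \<sigma> k" using j(2) \<sigma>_double[of j k] \<sigma>_pos[of j] by (cases "j = k") auto
      then have "(v / \<sigma> k)\<^sup>2 \<le> 1" using v \<open>0 < \<sigma>min\<close> \<sigma>_pos[of k] by (simp add: power_le_one_iff)
      then have "t * (v / \<sigma> k)\<^sup>2 \<le> t * 1" using \<open>t > 0\<close> by (intro mult_left_mono) auto
      then show "exp (t * (v / \<sigma> k)\<^sup>2 - 2 * t * 1) \<le> exp (- t)" by simp
    qed (use D in simp)
    \<comment> \<open>The index 0 does not occur in the sum, which keeps the number of terms below
      \<open>L\<close>.\<close>
    also have "\<dots> \<le> (\<Sum>k\<in>J - {0}. D * exp (- t))"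
      using J(1) \<open>0 < j\<close> D by (intro sum_mono2) auto
    also have "\<dots> = D * exp (- t) * real (card (J - {0}))" by simp
    also have "\<dots> \<le> D * exp (- t) * L" using J(3) D by (intro mult_left_mono) auto
    finally show ?thesis by (simp add: mult_ac)
  next
    case True
    show ?thesis
    \<comment> \<open>For small \<open>t\<close> the asserted bound is at least 1, because
      \<open>2 \<le> D\<close> and \<open>1 \<le> L\<close>.\<close>
    proof (cases "t \<le> ln 2")
      case True
      have "1 = 2 * exp (- ln 2 :: real)" by (simp add: exp_minus)
      also have "\<dots> \<le> D * exp (- t)" using D True by (intro mult_mono) auto
      also have "\<dots> \<le> D * exp (- t) * L"
        using D L mult_left_mono[of 1 L "D * exp (- t)"] by simp
      finally have "prob bad \<le> D * exp (- t) * L" by (rule order_trans[OF prob_le_1])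
      then show ?thesis by (simp add: mult_ac)
    next
      case False
      \<comment> \<open>Weight 2 at the index 0 is compatible with weight 1 elsewhere because
        \<open>2 * \<sigma> 0 \<le> \<sigma> k\<close> for \<open>0 < k\<close>, and its loss
        \<open>4 * v\<close> is within the budget \<open>6 * v\<close>. It lowers the exponent at 0
        from \<open>- t\<close> to \<open>- 3 * t\<close>.\<close>
      define c where "c = (\<lambda>k::int. if k = 0 then 2 else 1 :: real)"
      have "prob bad \<le> (\<Sum>k\<in>{k\<in>J. 0 \<le> k}. D * exp (t * (v / \<sigma> k)\<^sup>2 - 2 * t * c k))"
        using \<sigma>_double[of 0] \<sigma>0 True v \<open>0 < \<sigma>min\<close> by (intro bad_le J) (auto simp: c_def)
      also have "{k\<in>J. 0 \<le> k} = insert 0 (J - {0})" using J(2,4) by auto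
      also have "(\<Sum>k\<in>insert 0 (J - {0}). D * exp (t * (v / \<sigma> k)\<^sup>2 - 2 * t * c k))
          = D * exp (t - 4 * t) + (\<Sum>k\<in>J - {0}. D * exp (t * (v / \<sigma> k)\<^sup>2 - 2 * t * c k))"
        using J(1) True \<sigma>0 \<open>0 < \<sigma>min\<close> by (subst sum.insert) (simp_all add: c_def)
      also have "(\<Sum>k\<in>J - {0}. D * exp (t * (v / \<sigma> k)\<^sup>2 - 2 * t * c k))
          \<le> (\<Sum>k\<in>J - {0}. D * exp (t / 4 - 2 * t))"
      proof (intro sum_mono mult_left_mono)
        fix k assume k: "k \<in> J - {0}"
        \<comment> \<open>All other scales are at least twice \<open>v\<close>, so their variance
          term drops to \<open>t / 4\<close>; this gain pays for the extra index.\<close>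
        then have "2 * v \<le> \<sigma> k" using \<sigma>_double[of 0 k] J(4)[of k] True \<sigma>0 by auto
        then have "v / \<sigma> k \<le> 1 / 2" using \<sigma>_pos[of k] by (simp add: field_simps)
        then have "(v / \<sigma> k)\<^sup>2 \<le> (1 / 2)\<^sup>2"
          using v \<open>0 < \<sigma>min\<close> \<sigma>_pos[of k] by (intro power_mono) auto
        then have "t * (v / \<sigma> k)\<^sup>2 \<le> t * (1 / 2)\<^sup>2" using \<open>t > 0\<close> by (intro mult_left_mono) auto
        also have "\<dots> = t / 4" by (simp add: power2_eq_square)
        finally show "exp (t * (v / \<sigma> k)\<^sup>2 - 2 * t * c k) \<le> exp (t / 4 - 2 * t)"
          using k unfolding c_def exp_le_cancel_iff by auto
      qed (use D in simp)
      also have "D * exp (t - 4 * t) + (\<Sum>k\<in>J - {0}. D * exp (t / 4 - 2 * t))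
          = D * (exp (t - 4 * t) + real (card (J - {0})) * exp (t / 4 - 2 * t))"
        by (simp add: algebra_simps)
      also have "\<dots> \<le> D * (L * exp (- t))"
        using D J(3) L False by (intro mult_left_mono exp_sum_bound) auto
      finally show ?thesis by (simp add: mult_ac)
    qed
  qed
  then show ?thesis
    unfolding Let_def bad_def T_def \<theta>_def J_def \<sigma>_def EYbar_def s_def v_def S_def D_def L_def .
qed

end
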